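(* Let $S$ be a strongly $E^*$-unitary inverse semigroup (with zero) and $R$ a commutative unital ring. Then $L_R(S)\cong A_R(\mathcal G_{\mathrm{tight}}(S))$, where $\mathcal G_{\mathrm{tight}}(S)$ is Exel's groupoid of tight representations (tight groupoid) of $S$ and $A_R$ denotes the Steinberg algebra over $R$.
   Context: $S$ is an inverse semigroup with zero, $s^*$ the unique inverse of $s$, $E$ its idempotents (a meet semilattice with $x\wedge y=xy$, least element $0$), $S^\times=S\setminus\{0\}$, $E^\times=E\setminus\{0\}$. A pure grading is a map $\varphi:S^\times\to G$ to a group with $\varphi(ab)=\varphi(a)\varphi(b)$ whenever $ab\ne0$ and $\varphi^{-1}(1_G)=E^\times$; $S$ is strongly $E^*$-unitary if it has one. For $g\in G$, $E_g=\{x\in E: x\le ss^*$ for some $s$ with $\varphi(s)=g\}$ if $\varphi^{-1}(g)\ne\emptyset$, else $\{0\}$. $\phi_g:E_{g^{-1}}\to E_g$, $x\mapsto sxs^*$ (any $s$ with $\varphi(s)=g$, $x\le s^*s$) is a meet-semilattice isomorphism. For a meet semilattice $P$ with $0$: a filter is a subset $F$, $\emptyset\ne F\ne P$, closed upwards and under meets; $F(P)$ has topology generated by $\{F:x\in F\}$; tight filters $T(P)$ are the closure of the ultrafilters; $V^P_{(x:x_1,\dots,x_n)}=\{\xi\in T(P):x\in\xi, x_i\notin\xi\}$; $\mathcal T_c(P)$ is the generalized Boolean algebra of compact open subsets of $T(P)$. $\mathcal T_c(E_g)$ is identified with the ideal of $\mathcal T_c(E)$ of compact open sets contained in $\bigcup_{x\in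 E_g}V^E_x$, and $\hat\phi_g:\mathcal T_c(E_{g^{-1}})\to\mathcal T_c(E_g)$ is the isomorphism induced by $\phi_g$ ($V_{(x:x_1,\dots,x_n)}\mapsto V_{(\phi_g(x):\phi_g(x_1),\dots,\phi_g(x_n))}$). $\Phi=(\{\mathcal T_c(E_g)\},\{\hat\phi_g\})$ is a partial action of $G$ on $\mathcal T_c(E)$. For a partial action $\Phi=(\{\mathcal I_t\},\{\phi_t\})$ on a generalized Boolean algebra $\mathcal B$ and commutative unital ring $R$: $\mathrm{Lc}(R,\mathcal B)$ is the $R$-algebra of functions $f:R\setminus\{0\}\to\mathcal B$ with pairwise disjoint values, almost all $0$, viewed as the function $\sum_r r1_{f(r)}$ (equivalently locally constant compactly supported $R$-valued functions on the Stone dual of $\mathcal B$); $\mathrm{Lc}(R,\mathcal B)\rtimes_\Phi G$ consists of finite sums $\sum_t f_t\delta_t$, $f_t\in\mathrm{Lc}(R,\mathcal I_t)$, with $(a\delta_s)(b\delta_t)=\tilde\phi_s(\tilde\phi_{s^{-1}}(a)b)\delta_{st}$, $\tilde\phi_t(f)=\phi_t\circ f$. $L_R(S,\varphi):=\mathrm{Lc}(R,\mathcal T_c(E))\rtimes_\Phi G$; up to isomorphism it does not depend on the pure grading, and is written $L_R(S)$.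
   Formalization: The space of filters carries Exel's topology, with basic open sets {F : x∈F, x_1,…,x_n∉F}, instead of the one generated only by {F : x∈F}, under which every filter would be tight and the compact open sets would not form a generalized Boolean algebra. *)

theory Defs
  imports "HOL-Analysis.Analysis" "HOL-Algebra.Group"
begin

definition inverse_semigroup_zero :: "('a \<Rightarrow> 'a \<Rightarrow> 'a) \<Rightarrow> 'a \<Rightarrow> bool" where
  "inverse_semigroup_zero m z \<longleftrightarrow>
     (\<forall>a b c. m (m a b) c = m a (m b c)) \<and>
     (\<forall>a. m z a = z \<and> m a z = z) \<and>
     (\<forall>a. \<exists>!b. m (m a b) a = a \<and> m (m b a) b = b)"

context
  fixes m :: "'a \<Rightarrow> 'a \<Rightarrow> 'a"
begin

definition sinv :: "'a \<Rightarrow> 'a" where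
  "sinv a = (THE b. m (m a b) a = a \<and> m (m b a) b = b)"

definition IdemE :: "'a set" where
  "IdemE = {x. m x x = x}"

definition leqE :: "'a \<Rightarrow> 'a \<Rightarrow> bool" where
  "leqE x y \<longleftrightarrow> x = m x y"

definition is_filter :: "'a set \<Rightarrow> bool" where
  "is_filter F \<longleftrightarrow> F \<subseteq> IdemE \<and> F \<noteq> {} \<and> F \<noteq> IdemE \<and>
     (\<forall>x\<in>F. \<forall>y\<in>IdemE. leqE x y \<longrightarrow> y \<in> F) \<and>
     (\<forall>x\<in>F. \<forall>y\<in>F. m x y \<in> F)"

definition Filt :: "'a set set" where
  "Filt = {F. is_filter F}"

definition Ultra :: "'a set set" where
  "Ultra = {F \<in> Filt. \<forall>F'\<in>Filt. F \<subseteq> F' \<longrightarrow> F' = F}"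

definition Vfilt :: "'a \<Rightarrow> 'a set \<Rightarrow> 'a set set" where
  "Vfilt x X = {F \<in> Filt. x \<in> F \<and> X \<inter> F = {}}"

definition Ftop :: "'a set topology" where
  "Ftop = topology_generated_by
     {Vfilt x X | x X. x \<in> IdemE \<and> finite X \<and> X \<subseteq> IdemE}"

definition Tight :: "'a set set" where
  "Tight = Ftop closure_of Ultra"

definition Ttop :: "'a set topology" where
  "Ttop = subtopology Ftop Tight"

definition Vt :: "'a \<Rightarrow> 'a set set" where
  "Vt x = {\<xi> \<in> Tight. x \<in> \<xi>}"

definition theta :: "'a \<Rightarrow> 'a set \<Rightarrow> 'a set" where
  "theta s \<xi> = {f \<in> IdemE. \<exists>e\<in>\<xi>. leqE (m (m s e) (sinv s)) f}"

definition germ :: "'a \<Rightarrow> 'a set \<Rightarrow> ('a \<times> 'a set) set" where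
  "germ s \<xi> = {(t, \<eta>). \<eta> = \<xi> \<and> m (sinv t) t \<in> \<eta> \<and> (\<exists>e\<in>\<xi>. m s e = m t e)}"

definition Gtight :: "('a \<times> 'a set) set set" where
  "Gtight = {germ s \<xi> | s \<xi>. \<xi> \<in> Tight \<and> m (sinv s) s \<in> \<xi>}"

definition grep :: "('a \<times> 'a set) set \<Rightarrow> 'a \<times> 'a set" where
  "grep \<gamma> = (SOME p. p \<in> \<gamma>)"

definition gsrc :: "('a \<times> 'a set) set \<Rightarrow> 'a set" where
  "gsrc \<gamma> = snd (grep \<gamma>)"

definition grng :: "('a \<times> 'a set) set \<Rightarrow> 'a set" where
  "grng \<gamma> = theta (fst (grep \<gamma>)) (snd (grep \<gamma>))"

text \<open>[s,xi][t,eta] = [st,eta] (when xi = theta_t(eta))\<close>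
definition gmul :: "('a \<times> 'a set) set \<Rightarrow> ('a \<times> 'a set) set \<Rightarrow> ('a \<times> 'a set) set" where
  "gmul \<gamma> \<delta> = germ (m (fst (grep \<gamma>)) (fst (grep \<delta>))) (snd (grep \<delta>))"

definition Gtop :: "('a \<times> 'a set) set topology" where
  "Gtop = topology_generated_by
     {(\<lambda>\<xi>. germ s \<xi>) ` U | s U. openin Ttop U \<and> U \<subseteq> Vt (m (sinv s) s)}"

definition compact_open_bisection :: "('a \<times> 'a set) set set \<Rightarrow> bool" where
  "compact_open_bisection B \<longleftrightarrow> compactin Gtop B \<and> openin Gtop B \<and>
     inj_on gsrc B \<and> inj_on grng B"

end

record ('e, 'r) ralg =
  carr :: "'e set"
  add  :: "'e \<Rightarrow> 'e \<Rightarrow> 'e"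
  mul  :: "'e \<Rightarrow> 'e \<Rightarrow> 'e"
  smul :: "'r \<Rightarrow> 'e \<Rightarrow> 'e"

definition ralg_iso :: "('e, 'r) ralg \<Rightarrow> ('f, 'r) ralg \<Rightarrow> ('e \<Rightarrow> 'f) \<Rightarrow> bool" where
  "ralg_iso A B \<Phi> \<longleftrightarrow> bij_betw \<Phi> (carr A) (carr B) \<and>
     (\<forall>x\<in>carr A. \<forall>y\<in>carr A.
        \<Phi> (add A x y) = add B (\<Phi> x) (\<Phi> y) \<and> \<Phi> (mul A x y) = mul B (\<Phi> x) (\<Phi> y)) \<and>
     (\<forall>r. \<forall>x\<in>carr A. \<Phi> (smul A r x) = smul B r (\<Phi> x))"

definition ralg_isomorphic :: "('e, 'r) ralg \<Rightarrow> ('f, 'r) ralg \<Rightarrow> bool" where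
  "ralg_isomorphic A B \<longleftrightarrow> (\<exists>\<Phi>. ralg_iso A B \<Phi>)"

definition steinberg_tight ::
  "('a \<Rightarrow> 'a \<Rightarrow> 'a) \<Rightarrow> (('a \<times> 'a set) set \<Rightarrow> 'r::comm_ring_1, 'r) ralg" where
  "steinberg_tight m =
    \<lparr> carr = {f. \<exists>(n::nat) r U. (\<forall>i<n. compact_open_bisection m (U i)) \<and>
                 f = (\<lambda>\<gamma>. \<Sum>i<n. r i * (if \<gamma> \<in> U i then 1 else 0))},
      add = (\<lambda>f g \<gamma>. f \<gamma> + g \<gamma>),
      mul = (\<lambda>f g \<gamma>. \<Sum>(\<alpha>, \<beta>) \<in> {(\<alpha>, \<beta>). \<alpha> \<in> Gtight m \<and> \<beta> \<in> Gtight m \<and>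
                  gsrc \<alpha> = grng m \<beta> \<and> gmul m \<alpha> \<beta> = \<gamma> \<and> f \<alpha> \<noteq> 0 \<and> g \<beta> \<noteq> 0}.
                f \<alpha> * g \<beta>),
      smul = (\<lambda>r f \<gamma>. r * f \<gamma>) \<rparr>"

definition pure_grading ::
  "('a \<Rightarrow> 'a \<Rightarrow> 'a) \<Rightarrow> 'a \<Rightarrow> ('g, 'b) monoid_scheme \<Rightarrow> ('a \<Rightarrow> 'g) \<Rightarrow> bool" where
  "pure_grading m z G \<phi> \<longleftrightarrow>
     (\<forall>a. a \<noteq> z \<longrightarrow> \<phi> a \<in> carrier G) \<and>
     (\<forall>a b. m a b \<noteq> z \<longrightarrow> \<phi> (m a b) = \<phi> a \<otimes>\<^bsub>G\<^esub> \<phi> b) \<and>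
     {a. a \<noteq> z \<and> \<phi> a = \<one>\<^bsub>G\<^esub>} = IdemE m - {z}"

context
  fixes m :: "'a \<Rightarrow> 'a \<Rightarrow> 'a" and z :: 'a
    and G :: "('g, 'b) monoid_scheme" and \<phi> :: "'a \<Rightarrow> 'g"
begin

definition Egr :: "'g \<Rightarrow> 'a set" where
  "Egr g = (if \<exists>s. s \<noteq> z \<and> \<phi> s = g
            then {x \<in> IdemE m. \<exists>s. s \<noteq> z \<and> \<phi> s = g \<and> leqE m x (m s (sinv m s))}
            else {z})"

text \<open>phi_g : E_{g^-1} \<rightarrow> E_g, x \<mapsto> s x s^*\<close>
definition phig :: "'g \<Rightarrow> 'a \<Rightarrow> 'a" where
  "phig g x = (let s = (SOME s. s \<noteq> z \<and> \<phi> s = g \<and> leqE m x (m (sinv m s) s))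
               in m (m s x) (sinv m s))"

text \<open>the open set of T(E) corresponding to the ideal T_c(E_g): union of V_x, x in E_g\<close>
definition Dg :: "'g \<Rightarrow> 'a set set" where
  "Dg g = (\<Union>x\<in>Egr g. Vt m x)"

text \<open>the map of tight filters induced by phi_g (Stone dual of hat phi_g)\<close>
definition hg :: "'g \<Rightarrow> 'a set \<Rightarrow> 'a set" where
  "hg g \<xi> = {y \<in> IdemE m. \<exists>x \<in> \<xi> \<inter> Egr (inv\<^bsub>G\<^esub> g). leqE m (phig g x) y}"

definition Tcg :: "'g \<Rightarrow> 'a set set set" where
  "Tcg g = {A. compactin (Ttop m) A \<and> openin (Ttop m) A \<and> A \<subseteq> Dg g}"

text \<open>Lc(R, T_c(E_g)), elements viewed as functions sum r 1_{f(r)} on T(E)\<close>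
definition Lcg :: "'g \<Rightarrow> ('a set \<Rightarrow> 'r::comm_ring_1) set" where
  "Lcg g = {f. (\<forall>\<eta>. \<eta> \<notin> Tight m \<longrightarrow> f \<eta> = 0) \<and> finite (range f) \<and>
               (\<forall>r. r \<noteq> 0 \<longrightarrow> {\<eta>. f \<eta> = r} \<in> Tcg g)}"

text \<open>tilde phi_g(f) = hat phi_g o f\<close>
definition tphi :: "'g \<Rightarrow> ('a set \<Rightarrow> 'r::comm_ring_1) \<Rightarrow> 'a set \<Rightarrow> 'r" where
  "tphi g f \<eta> = (if \<eta> \<in> Dg g then f (hg (inv\<^bsub>G\<^esub> g) \<eta>) else 0)"

text \<open>L_R(S, phi) = Lc(R, T_c(E)) \<rtimes>_Phi G; an element sum_t f_t delta_t is the
  finitely supported map t \<mapsto> f_t\<close>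
definition LR :: "('g \<Rightarrow> 'a set \<Rightarrow> 'r::comm_ring_1, 'r) ralg" where
  "LR = \<lparr> carr = {x. (\<forall>g. g \<notin> carrier G \<longrightarrow> x g = (\<lambda>_. 0)) \<and>
                    finite {g \<in> carrier G. x g \<noteq> (\<lambda>_. 0)} \<and>
                    (\<forall>g\<in>carrier G. x g \<in> Lcg g)},
          add = (\<lambda>x y g \<eta>. x g \<eta> + y g \<eta>),
          mul = (\<lambda>x y g \<eta>. if g \<in> carrier G then
                    (\<Sum>s \<in> {s \<in> carrier G. x s \<noteq> (\<lambda>_. 0)}.
                       tphi s (\<lambda>\<xi>. tphi (inv\<^bsub>G\<^esub> s) (x s) \<xi> * y (inv\<^bsub>G\<^esub> s \<otimes>\<^bsub>G\<^esub> g) \<xi>) \<eta>)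
                  else 0),
          smul = (\<lambda>r x g \<eta>. r * x g \<eta>) \<rparr>"

end

end

theory Submission
  imports Defs
begin

text \<open>
  A germ is determined by its degree and its range: two semigroup elements of equal degree agree
  below their common domain, because the grading is pure. Hence the tight groupoid is, as a
  topological space, the disjoint union over \<open>g\<close> of the open sets \<open>Dg g\<close> of tight filters, and the
  isomorphism sends \<open>\<Sum>\<^sub>g f\<^sub>g \<delta>\<^sub>g\<close> to the function whose value at a germ of degree \<open>g\<close> and range
  \<open>\<eta>\<close> is \<open>f\<^sub>g \<eta>\<close>.
\<close>

section \<open>Inverse semigroups and their idempotents\<close>

text \<open>The two sides are compared through points. \<open>hg_eq\<close> identifies the map
  \<open>hg\<close>, dual to \<open>phig\<close>, with Exel's action \<open>theta\<close>, so no
  isomorphism of Boolean algebras has to be handled. The range rather than the source is the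
  coordinate because the coefficient at \<open>g\<close> lives over \<open>Dg g\<close>, which is
  built from range idempotents, and because the product of \<open>a\<close> in degree
  \<open>s\<close> with \<open>b\<close> in degree \<open>t\<close>, evaluated at a filter
  \<open>F\<close>, is \<open>a F\<close> times the value of \<open>b\<close> at the image of
  \<open>F\<close> under degree \<open>s\<close> inverse. That is one term of a convolution: once
  the degree of the left factor is chosen, a germ factors in at most one way. The obstacle is
  surjectivity. A compact open bisection may spread over several degrees. The pieces of constant
  degree are disjoint and clopen, so a compact set meets only finitely many of them, and meets each
  in a compact set. Representatives of germs, and the elements that implement \<open>phig\<close>,
  are picked by \<open>SOME\<close>; purity or agreement on an element of the filter makes each such
  choice harmless.\<close>

locale inverse_semigroup =
  fixes m :: "'a \<Rightarrow> 'a \<Rightarrow> 'a" (infixl "\<cdot>" 70) and z :: 'a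
  assumes inverse_semigroup_zero: "inverse_semigroup_zero m z"
begin

abbreviation star :: "'a \<Rightarrow> 'a" ("_\<^sup>\<star>" [1000] 1000) where "s\<^sup>\<star> \<equiv> sinv m s"
abbreviation leq (infix "\<preceq>" 50) where "x \<preceq> y \<equiv> leqE m x y"
abbreviation E where "E \<equiv> IdemE m"

lemma assoc: "a \<cdot> b \<cdot> c = a \<cdot> (b \<cdot> c)"
  using inverse_semigroup_zero by (auto simp: inverse_semigroup_zero_def)

lemma zero_left [simp]: "z \<cdot> a = z" and zero_right [simp]: "a \<cdot> z = z"
  using inverse_semigroup_zero by (auto simp: inverse_semigroup_zero_def)

lemma ex1_sinv: "\<exists>!b. a \<cdot> b \<cdot> a = a \<and> b \<cdot> a \<cdot> b = b"
  using inverse_semigroup_zero unfolding inverse_semigroup_zero_def by blast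

lemma sinv_props: "a \<cdot> a\<^sup>\<star> \<cdot> a = a \<and> a\<^sup>\<star> \<cdot> a \<cdot> a\<^sup>\<star> = a\<^sup>\<star>"
  unfolding sinv_def by (rule theI'[OF ex1_sinv])

lemma sinv_cancel [simp]:
  "a \<cdot> (a\<^sup>\<star> \<cdot> a) = a" "a\<^sup>\<star> \<cdot> (a \<cdot> a\<^sup>\<star>) = a\<^sup>\<star>"
  "a \<cdot> (a\<^sup>\<star> \<cdot> (a \<cdot> b)) = a \<cdot> b" "a\<^sup>\<star> \<cdot> (a \<cdot> (a\<^sup>\<star> \<cdot> b)) = a\<^sup>\<star> \<cdot> b"
  using sinv_props[of a] by (simp_all flip: assoc)

lemma sinv_unique: "a \<cdot> b \<cdot> a = a \<Longrightarrow> b \<cdot> a \<cdot> b = b \<Longrightarrow> a\<^sup>\<star> = b"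
  using ex1_sinv[of a] sinv_props[of a] by blast

lemma sinv_sinv [simp]: "a\<^sup>\<star>\<^sup>\<star> = a"
  by (rule sinv_unique) (simp_all add: assoc)

lemma EI: "x \<cdot> x = x \<Longrightarrow> x \<in> E"
  by (simp add: IdemE_def)

lemma E_idem: "x \<in> E \<Longrightarrow> x \<cdot> x = x"
  by (simp add: IdemE_def)

lemma E_idem_left: "x \<in> E \<Longrightarrow> x \<cdot> (x \<cdot> y) = x \<cdot> y"
  by (simp add: E_idem flip: assoc)

lemma sinv_idem [simp]: "x \<in> E \<Longrightarrow> x\<^sup>\<star> = x"
  by (rule sinv_unique) (simp_all add: E_idem)

text \<open>By uniqueness of inverses, the inverse \<open>x\<close> of the product equals
  \<open>f \<cdot> x \<cdot> e\<close>. This form makes \<open>x\<close> idempotent, hence equal to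
  its own inverse, which is the product.\<close>

lemma E_mult [simp]:
  assumes "e \<in> E" "f \<in> E"
  shows "e \<cdot> f \<in> E"
proof -
  define x where "x = (e \<cdot> f)\<^sup>\<star>"
  have x: "e \<cdot> (f \<cdot> (x \<cdot> (e \<cdot> f))) = e \<cdot> f" "x \<cdot> (e \<cdot> (f \<cdot> x)) = x"
    using sinv_props[of "e \<cdot> f"] by (simp_all add: x_def assoc)
  have x': "x \<cdot> (e \<cdot> (f \<cdot> (x \<cdot> w))) = x \<cdot> w" for w
    using x(2) by (metis assoc)
  have 1: "x = f \<cdot> x \<cdot> e"
    unfolding x_def by (rule sinv_unique, fold x_def)
      (simp_all add: assoc x x' E_idem_left[OF assms(1)] E_idem_left[OF assms(2)])
  have "x \<cdot> x = f \<cdot> x \<cdot> e \<cdot> (f \<cdot> x \<cdot> e)"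
    using 1 by simp
  also have "\<dots> = x"
    by (subst (3) 1) (simp add: assoc x')
  finally have "x \<in> E"
    by (rule EI)
  moreover have "x\<^sup>\<star> = e \<cdot> f"
    by (simp add: x_def)
  ultimately show ?thesis
    by simp
qed

text \<open>Both products are idempotent, so \<open>f \<cdot> e\<close> is an inverse of
  \<open>e \<cdot> f\<close>; but an idempotent is its own inverse.\<close>

lemma E_commute:
  assumes "e \<in> E" "f \<in> E"
  shows "e \<cdot> f = f \<cdot> e"
proof -
  have ef: "e \<cdot> (f \<cdot> (e \<cdot> f)) = e \<cdot> f" "f \<cdot> (e \<cdot> (f \<cdot> e)) = f \<cdot> e"
    using E_idem[OF E_mult[OF assms]] E_idem[OF E_mult[OF assms(2,1)]] by (simp_all add: assoc)
  have "(e \<cdot> f)\<^sup>\<star> = f \<cdot> e"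
    by (rule sinv_unique)
      (simp_all add: assoc ef E_idem_left[OF assms(1)] E_idem_left[OF assms(2)])
  then show ?thesis
    using assms by simp
qed

lemma E_left_commute: "e \<in> E \<Longrightarrow> f \<in> E \<Longrightarrow> e \<cdot> (f \<cdot> x) = f \<cdot> (e \<cdot> x)"
  by (metis E_commute assoc)

lemma E_zero [simp]: "z \<in> E"
  by (simp add: IdemE_def)

lemma E_dom [simp]: "a\<^sup>\<star> \<cdot> a \<in> E" and E_ran [simp]: "a \<cdot> a\<^sup>\<star> \<in> E"
  by (simp_all add: IdemE_def assoc)

text \<open>Oriented as a rewrite rule: in right-nested products it pushes an idempotent to the
  right past \<open>s \<cdot> s\<^sup>\<star>\<close>, which is how the conjugation identities below
  are normalised.\<close>

lemma commute_ran: "e \<in> E \<Longrightarrow> e \<cdot> (s \<cdot> s\<^sup>\<star>) = s \<cdot> (s\<^sup>\<star> \<cdot> e)"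
  using E_commute[of e "s \<cdot> s\<^sup>\<star>"] by (simp add: assoc)

lemma commute_ran_left: "e \<in> E \<Longrightarrow> e \<cdot> (s \<cdot> (s\<^sup>\<star> \<cdot> x)) = s \<cdot> (s\<^sup>\<star> \<cdot> (e \<cdot> x))"
  using commute_ran[of e s] by (metis assoc)

lemma E_conj [simp]: "e \<in> E \<Longrightarrow> s\<^sup>\<star> \<cdot> e \<cdot> s \<in> E"
  by (rule EI) (simp add: assoc commute_ran_left E_idem_left)

lemma E_conj' [simp]: "e \<in> E \<Longrightarrow> s \<cdot> e \<cdot> s\<^sup>\<star> \<in> E"
  using E_conj[of e "s\<^sup>\<star>"] by simp

lemma conj_mult:
  "e \<in> E \<Longrightarrow> f \<in> E \<Longrightarrow> (s\<^sup>\<star> \<cdot> e \<cdot> s) \<cdot> (s\<^sup>\<star> \<cdot> f \<cdot> s) = s\<^sup>\<star> \<cdot> (e \<cdot> f) \<cdot> s"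
  by (simp add: assoc commute_ran_left)

lemma sinv_mult: "(a \<cdot> b)\<^sup>\<star> = b\<^sup>\<star> \<cdot> a\<^sup>\<star>"
proof (rule sinv_unique)
  have *: "b \<cdot> (b\<^sup>\<star> \<cdot> (a\<^sup>\<star> \<cdot> (a \<cdot> x))) = a\<^sup>\<star> \<cdot> (a \<cdot> (b \<cdot> (b\<^sup>\<star> \<cdot> x)))" for x
    using E_left_commute[OF E_ran[of b] E_dom[of a], of x] by (simp add: assoc)
  show "a \<cdot> b \<cdot> (b\<^sup>\<star> \<cdot> a\<^sup>\<star>) \<cdot> (a \<cdot> b) = a \<cdot> b"
    by (simp add: assoc *)
  show "b\<^sup>\<star> \<cdot> a\<^sup>\<star> \<cdot> (a \<cdot> b) \<cdot> (b\<^sup>\<star> \<cdot> a\<^sup>\<star>) = b\<^sup>\<star> \<cdot> a\<^sup>\<star>"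
    by (simp add: assoc *[symmetric])
qed

lemma leqD: "x \<preceq> y \<Longrightarrow> x \<cdot> y = x"
  by (simp add: leqE_def)

lemma leq_refl [simp]: "x \<in> E \<Longrightarrow> x \<preceq> x"
  by (simp add: leqE_def E_idem)

lemma leq_trans: "x \<preceq> y \<Longrightarrow> y \<preceq> w \<Longrightarrow> x \<preceq> w"
  by (metis leqE_def assoc)

lemma leq_mult_right: "x \<in> E \<Longrightarrow> y \<in> E \<Longrightarrow> x \<cdot> y \<preceq> y"
  by (simp add: leqE_def assoc E_idem)

lemma leq_mult_left: "x \<in> E \<Longrightarrow> y \<in> E \<Longrightarrow> x \<cdot> y \<preceq> x"
  by (metis leq_mult_right E_commute)

lemma conj_mono: "e \<in> E \<Longrightarrow> f \<in> E \<Longrightarrow> e \<preceq> f \<Longrightarrow> s\<^sup>\<star> \<cdot> e \<cdot> s \<preceq> s\<^sup>\<star> \<cdot> f \<cdot> s"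
  by (simp add: leqE_def conj_mult)

lemma conj'_mono: "e \<in> E \<Longrightarrow> f \<in> E \<Longrightarrow> e \<preceq> f \<Longrightarrow> s \<cdot> e \<cdot> s\<^sup>\<star> \<preceq> s \<cdot> f \<cdot> s\<^sup>\<star>"
  using conj_mono[of e f "s\<^sup>\<star>"] by simp

section \<open>Filters and the action on them\<close>

text \<open>Upward closure and closure under meets merge into a single equivalence, convenient for
  rewriting. Since \<open>z\<close> lies below every idempotent, an upward closed set is proper
  exactly when it avoids \<open>z\<close>.\<close>

lemma Filt_iff:
  "F \<in> Filt m \<longleftrightarrow> F \<subseteq> E \<and> F \<noteq> {} \<and> z \<notin> F \<and>
     (\<forall>x\<in>E. \<forall>y\<in>E. x \<cdot> y \<in> F \<longleftrightarrow> x \<in> F \<and> y \<in> F)" (is "?L \<longleftrightarrow> ?R")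
proof
  assume L: ?L
  then have F: "F \<subseteq> E" "F \<noteq> {}" "F \<noteq> E"
    and up: "\<And>x y. x \<in> F \<Longrightarrow> y \<in> E \<Longrightarrow> x \<preceq> y \<Longrightarrow> y \<in> F"
    and mu: "\<And>x y. x \<in> F \<Longrightarrow> y \<in> F \<Longrightarrow> x \<cdot> y \<in> F"
    unfolding Filt_def is_filter_def by auto
  have "z \<notin> F"
    using up[of z] F by (auto simp: leqE_def)
  moreover have "x \<cdot> y \<in> F \<longleftrightarrow> x \<in> F \<and> y \<in> F" if "x \<in> E" "y \<in> E" for x y
    using that mu[of x y] up[of "x \<cdot> y" x] up[of "x \<cdot> y" y] leq_mult_left leq_mult_right by auto
  ultimately show ?R
    using F by simp
next
  assume R: ?R
  then have F: "F \<subseteq> E" "F \<noteq> {}" "z \<notin> F"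
    and mu: "\<And>x y. x \<in> E \<Longrightarrow> y \<in> E \<Longrightarrow> x \<cdot> y \<in> F \<longleftrightarrow> x \<in> F \<and> y \<in> F"
    by simp_all
  have "y \<in> F" if "x \<in> F" "y \<in> E" "x \<preceq> y" for x y
    using mu[of x y] leqD[of x y] that F(1) by auto
  moreover have "x \<cdot> y \<in> F" if "x \<in> F" "y \<in> F" for x y
    using mu[of x y] that F(1) by auto
  moreover have "F \<noteq> E"
    using F(3) E_zero by blast
  ultimately show ?L
    using F unfolding Filt_def is_filter_def by simp
qed

lemma Filt_E: "F \<in> Filt m \<Longrightarrow> x \<in> F \<Longrightarrow> x \<in> E"
  and Filt_zero: "F \<in> Filt m \<Longrightarrow> z \<notin> F"
  and Filt_mult: "F \<in> Filt m \<Longrightarrow> x \<in> E \<Longrightarrow> y \<in> E \<Longrightarrow> x \<cdot> y \<in> F \<longleftrightarrow> x \<in> F \<and> y \<in> F"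
  by (auto simp: Filt_iff)

lemma Filt_multI: "F \<in> Filt m \<Longrightarrow> x \<in> F \<Longrightarrow> y \<in> F \<Longrightarrow> x \<cdot> y \<in> F"
  by (simp add: Filt_E Filt_mult)

lemma Filt_up: "F \<in> Filt m \<Longrightarrow> x \<in> F \<Longrightarrow> y \<in> E \<Longrightarrow> x \<preceq> y \<Longrightarrow> y \<in> F"
  by (metis Filt_E Filt_mult leqD)

text \<open>Replaces the upward closure in \<open>theta\<close> by a preimage under conjugation,
  which is multiplicative by \<open>conj_mult\<close>. Conjugating an inequality back gives one
  direction; for the other, the conjugate of \<open>f\<close> itself serves as witness.\<close>

lemma mem_theta_iff:
  assumes F: "F \<in> Filt m" and s: "s\<^sup>\<star> \<cdot> s \<in> F"
  shows "f \<in> theta m s F \<longleftrightarrow> f \<in> E \<and> s\<^sup>\<star> \<cdot> f \<cdot> s \<in> F"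
proof
  assume "f \<in> theta m s F"
  then obtain e where e: "f \<in> E" "e \<in> F" "s \<cdot> e \<cdot> s\<^sup>\<star> \<preceq> f"
    by (auto simp: theta_def)
  have eE: "e \<in> E"
    using e F Filt_E by blast
  have "s\<^sup>\<star> \<cdot> (s \<cdot> e \<cdot> s\<^sup>\<star>) \<cdot> s = e \<cdot> (s\<^sup>\<star> \<cdot> s)"
    using commute_ran[of e "s\<^sup>\<star>"] eE by (simp add: assoc)
  then have "e \<cdot> (s\<^sup>\<star> \<cdot> s) \<preceq> s\<^sup>\<star> \<cdot> f \<cdot> s"
    using conj_mono[OF E_conj'[OF eE] e(1,3), of s] by simp
  then show "f \<in> E \<and> s\<^sup>\<star> \<cdot> f \<cdot> s \<in> F"
    using e(1) Filt_up[OF F Filt_multI[OF F e(2) s]] by auto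
next
  assume f: "f \<in> E \<and> s\<^sup>\<star> \<cdot> f \<cdot> s \<in> F"
  have "s \<cdot> (s\<^sup>\<star> \<cdot> f \<cdot> s) \<cdot> s\<^sup>\<star> = (s \<cdot> s\<^sup>\<star>) \<cdot> f"
    using f by (simp add: assoc commute_ran)
  then have "s \<cdot> (s\<^sup>\<star> \<cdot> f \<cdot> s) \<cdot> s\<^sup>\<star> \<preceq> f"
    using f leq_mult_right[of "s \<cdot> s\<^sup>\<star>" f] by simp
  then show "f \<in> theta m s F"
    using f by (auto simp: theta_def)
qed

lemma ran_mem_theta:
  assumes F: "F \<in> Filt m" and s: "s\<^sup>\<star> \<cdot> s \<in> F"
  shows "s \<cdot> s\<^sup>\<star> \<in> theta m s F"
  using s by (simp add: mem_theta_iff[OF F s] assoc)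

lemma theta_Filt:
  assumes F: "F \<in> Filt m" and s: "s\<^sup>\<star> \<cdot> s \<in> F"
  shows "theta m s F \<in> Filt m"
  unfolding Filt_iff
proof (intro conjI ballI)
  show "theta m s F \<subseteq> E"
    by (auto simp: theta_def)
  show "theta m s F \<noteq> {}"
    using ran_mem_theta[OF F s] by blast
  show "z \<notin> theta m s F"
    using Filt_zero[OF F] by (simp add: mem_theta_iff[OF F s])
  fix x y assume "x \<in> E" "y \<in> E"
  then show "x \<cdot> y \<in> theta m s F \<longleftrightarrow> x \<in> theta m s F \<and> y \<in> theta m s F"
    using Filt_mult[OF F, of "s\<^sup>\<star> \<cdot> x \<cdot> s" "s\<^sup>\<star> \<cdot> y \<cdot> s"]
    by (simp add: mem_theta_iff[OF F s] conj_mult)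
qed

text \<open>Two applications of \<open>mem_theta_iff\<close> multiply \<open>f\<close> on both sides
  by the domain idempotent of \<open>s\<close>, which belongs to \<open>F\<close> and so does not
  affect membership.\<close>

lemma theta_inverse:
  assumes F: "F \<in> Filt m" and s: "s\<^sup>\<star> \<cdot> s \<in> F"
  shows "theta m (s\<^sup>\<star>) (theta m s F) = F"
proof -
  have "f \<in> theta m (s\<^sup>\<star>) (theta m s F) \<longleftrightarrow> f \<in> F" for f
  proof -
    have "f \<in> theta m (s\<^sup>\<star>) (theta m s F) \<longleftrightarrow> f \<in> E \<and> s\<^sup>\<star> \<cdot> (s \<cdot> f \<cdot> s\<^sup>\<star>) \<cdot> s \<in> F"
      using mem_theta_iff[OF theta_Filt[OF F s], of "s\<^sup>\<star>" f] ran_mem_theta[OF F s]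
      by (auto simp: mem_theta_iff[OF F s])
    also have "\<dots> \<longleftrightarrow> f \<in> E \<and> (s\<^sup>\<star> \<cdot> s) \<cdot> f \<cdot> (s\<^sup>\<star> \<cdot> s) \<in> F"
      by (simp add: assoc)
    also have "\<dots> \<longleftrightarrow> f \<in> F"
      using s Filt_mult[OF F] Filt_E[OF F] by (metis E_dom E_mult)
    finally show ?thesis .
  qed
  then show ?thesis by blast
qed

lemma theta_mult:
  assumes F: "F \<in> Filt m" and t: "t\<^sup>\<star> \<cdot> t \<in> F" and s: "s\<^sup>\<star> \<cdot> s \<in> theta m t F"
  shows "(s \<cdot> t)\<^sup>\<star> \<cdot> (s \<cdot> t) \<in> F" "theta m (s \<cdot> t) F = theta m s (theta m t F)"
proof -
  show st: "(s \<cdot> t)\<^sup>\<star> \<cdot> (s \<cdot> t) \<in> F"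
    using s by (simp add: mem_theta_iff[OF F t] sinv_mult assoc)
  show "theta m (s \<cdot> t) F = theta m s (theta m t F)"
  proof (rule Set.set_eqI)
    fix f
    show "f \<in> theta m (s \<cdot> t) F \<longleftrightarrow> f \<in> theta m s (theta m t F)"
      using E_conj[of f s]
      by (simp add: mem_theta_iff[OF F st] mem_theta_iff[OF theta_Filt[OF F t] s]
          mem_theta_iff[OF F t] sinv_mult assoc) (auto simp: assoc)
  qed
qed

lemma theta_mono: "F \<subseteq> F' \<Longrightarrow> theta m s F \<subseteq> theta m s F'"
  by (auto simp: theta_def)

text \<open>A filter above the image contains the range idempotent of \<open>s\<close>, so it can be
  carried back by \<open>s\<^sup>\<star>\<close>; there the maximality of \<open>F\<close>
  applies.\<close>

lemma theta_Ultra: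
  assumes F: "F \<in> Ultra m" and s: "s\<^sup>\<star> \<cdot> s \<in> F"
  shows "theta m s F \<in> Ultra m"
proof -
  have FF: "F \<in> Filt m" and max: "\<And>F'. F' \<in> Filt m \<Longrightarrow> F \<subseteq> F' \<Longrightarrow> F' = F"
    using F by (auto simp: Ultra_def)
  have "F' = theta m s F" if F': "F' \<in> Filt m" "theta m s F \<subseteq> F'" for F'
  proof -
    have s': "s\<^sup>\<star>\<^sup>\<star> \<cdot> s\<^sup>\<star> \<in> F'"
      using ran_mem_theta[OF FF s] F' by auto
    have "F \<subseteq> theta m (s\<^sup>\<star>) F'"
      using theta_mono[OF F'(2), of "s\<^sup>\<star>"] theta_inverse[OF FF s] by simp
    then have "theta m (s\<^sup>\<star>) F' = F"
      using max theta_Filt[OF F'(1) s'] by blast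
    then show ?thesis
      using theta_inverse[OF F'(1) s'] by simp
  qed
  then show ?thesis
    using theta_Filt[OF FF s] by (auto simp: Ultra_def)
qed

section \<open>The topology on filters\<close>

text \<open>The generating sets are a base and not only a subbase: the sets given by
  \<open>x, X\<close> and \<open>y, Y\<close> intersect in the one given by
  \<open>x \<cdot> y\<close> and \<open>X \<union> Y\<close>.\<close>

lemma openin_Ftop_iff:
  "openin (Ftop m) U \<longleftrightarrow>
     (\<forall>F\<in>U. \<exists>x X. x \<in> E \<and> finite X \<and> X \<subseteq> E \<and> F \<in> Vfilt m x X \<and> Vfilt m x X \<subseteq> U)"
  (is "_ \<longleftrightarrow> ?R U")
proof
  assume "openin (Ftop m) U"
  then have "generate_topology_on {Vfilt m x X | x X. x \<in> E \<and> finite X \<and> X \<subseteq> E} U"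
    by (simp add: Ftop_def openin_topology_generated_by_iff)
  then show "?R U"
  proof induction
    case (Int U V)
    show ?case
    proof
      fix F assume "F \<in> U \<inter> V"
      then obtain x X y Y where h: "x \<in> E" "finite X" "X \<subseteq> E" "F \<in> Vfilt m x X" "Vfilt m x X \<subseteq> U"
        "y \<in> E" "finite Y" "Y \<subseteq> E" "F \<in> Vfilt m y Y" "Vfilt m y Y \<subseteq> V"
        using Int.IH by (metis IntE)
      have "Vfilt m (x \<cdot> y) (X \<union> Y) = Vfilt m x X \<inter> Vfilt m y Y"
        using h by (auto simp: Vfilt_def Filt_mult)
      then show "\<exists>x X. x \<in> E \<and> finite X \<and> X \<subseteq> E \<and> F \<in> Vfilt m x X \<and> Vfilt m x X \<subseteq> U \<inter> V"
        using h by (intro exI[of _ "x \<cdot> y"] exI[of _ "X \<union> Y"]) auto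
    qed
  next
    case (UN K)
    show ?case
    proof
      fix F assume "F \<in> \<Union>K"
      then obtain V where V: "V \<in> K" "F \<in> V" by blast
      then obtain x X where "x \<in> E" "finite X" "X \<subseteq> E" "F \<in> Vfilt m x X" "Vfilt m x X \<subseteq> V"
        using UN.IH[of V] by blast
      then show "\<exists>x X. x \<in> E \<and> finite X \<and> X \<subseteq> E \<and> F \<in> Vfilt m x X \<and> Vfilt m x X \<subseteq> \<Union>K"
        using V(1) by (intro exI[of _ x] exI[of _ X]) auto
    qed
  next
    case (Basis V)
    then obtain x X where "V = Vfilt m x X" "x \<in> E" "finite X" "X \<subseteq> E" by blast
    then show ?case
      by (intro ballI exI[of _ x] exI[of _ X]) simp
  qed simp
next
  assume R: "?R U"
  have "\<exists>V. openin (Ftop m) V \<and> F \<in> V \<and> V \<subseteq> U" if "F \<in> U" for F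
  proof -
    obtain x X where "x \<in> E" "finite X" "X \<subseteq> E" "F \<in> Vfilt m x X" "Vfilt m x X \<subseteq> U"
      using R \<open>F \<in> U\<close> by blast
    moreover from this have "openin (Ftop m) (Vfilt m x X)"
      unfolding Ftop_def by (intro topology_generated_by_Basis) blast
    ultimately show ?thesis by blast
  qed
  then show "openin (Ftop m) U"
    by (subst openin_subopen) blast
qed

lemma openin_Vfilt: "x \<in> E \<Longrightarrow> finite X \<Longrightarrow> X \<subseteq> E \<Longrightarrow> openin (Ftop m) (Vfilt m x X)"
  by (auto simp: openin_Ftop_iff)

lemma topspace_Ftop: "topspace (Ftop m) = Filt m"
proof
  show "topspace (Ftop m) \<subseteq> Filt m"
    unfolding Ftop_def topology_generated_by_topspace by (auto simp: Vfilt_def)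
  show "Filt m \<subseteq> topspace (Ftop m)"
  proof
    fix F assume F: "F \<in> Filt m"
    then obtain x where "x \<in> F" by (auto simp: Filt_iff)
    then have "F \<in> Vfilt m x {}" "x \<in> E"
      using F by (auto simp: Vfilt_def Filt_E)
    then show "F \<in> topspace (Ftop m)"
      using openin_subset[OF openin_Vfilt[of x "{}"]] by blast
  qed
qed

lemma Hausdorff_Ftop: "Hausdorff_space (Ftop m)"
proof -
  have sep: "\<exists>U V. openin (Ftop m) U \<and> openin (Ftop m) V \<and> F \<in> U \<and> F' \<in> V \<and> disjnt U V"
    if F: "F \<in> Filt m" "F' \<in> Filt m" "x \<in> F" "x \<notin> F'" for F F' x
  proof -
    \<comment> \<open>A basic set needs a positive condition besides the excluded \<open>x\<close>;
      any member of \<open>F'\<close> supplies one.\<close>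
    obtain y where y: "y \<in> F'"
      using F by (auto simp: Filt_iff)
    have "openin (Ftop m) (Vfilt m x {})" "openin (Ftop m) (Vfilt m y {x})"
      using F(3) y Filt_E[OF F(1)] Filt_E[OF F(2)] by (simp_all add: openin_Vfilt)
    moreover have "F \<in> Vfilt m x {}" "F' \<in> Vfilt m y {x}" "disjnt (Vfilt m x {}) (Vfilt m y {x})"
      using F y by (auto simp: Vfilt_def disjnt_def)
    ultimately show ?thesis by blast
  qed
  show ?thesis
    unfolding Hausdorff_space_def topspace_Ftop
    using sep by (metis disjnt_sym subset_antisym subsetI)
qed

text \<open>Closure is tested on basic sets only, since those are the sets that \<open>theta\<close>
  transports explicitly.\<close>

lemma Tight_iff:
  "F \<in> Tight m \<longleftrightarrow> F \<in> Filt m \<and>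
    (\<forall>x X. x \<in> E \<and> finite X \<and> X \<subseteq> E \<and> F \<in> Vfilt m x X \<longrightarrow> Ultra m \<inter> Vfilt m x X \<noteq> {})"
  (is "_ \<longleftrightarrow> ?R")
proof
  assume "F \<in> Tight m"
  then show ?R
    using openin_Vfilt unfolding Tight_def in_closure_of topspace_Ftop by blast
next
  assume R: ?R
  have "\<exists>y. y \<in> Ultra m \<and> y \<in> T" if T: "F \<in> T" "openin (Ftop m) T" for T
  proof -
    obtain x X where h: "x \<in> E" "finite X" "X \<subseteq> E" "F \<in> Vfilt m x X" "Vfilt m x X \<subseteq> T"
      using T unfolding openin_Ftop_iff by blast
    then have "Ultra m \<inter> Vfilt m x X \<noteq> {}"
      using R by blast
    then show ?thesis
      using h(5) by blast
  qed
  then show "F \<in> Tight m"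
    using R unfolding Tight_def in_closure_of topspace_Ftop by blast
qed

lemma Tight_Filt: "F \<in> Tight m \<Longrightarrow> F \<in> Filt m"
  by (simp add: Tight_iff)

lemma topspace_Ttop [simp]: "topspace (Ttop m) = Tight m"
  using Tight_Filt by (auto simp: Ttop_def topspace_subtopology topspace_Ftop)

lemma Hausdorff_Ttop: "Hausdorff_space (Ttop m)"
  by (simp add: Ttop_def Hausdorff_space_subtopology Hausdorff_Ftop)

lemma openin_Ttop_iff:
  "openin (Ttop m) U \<longleftrightarrow> U \<subseteq> Tight m \<and>
     (\<forall>F\<in>U. \<exists>x X. x \<in> E \<and> finite X \<and> X \<subseteq> E \<and> F \<in> Vfilt m x X \<and> Vfilt m x X \<inter> Tight m \<subseteq> U)"
  (is "_ \<longleftrightarrow> ?R")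
proof
  assume "openin (Ttop m) U"
  then obtain V where V: "openin (Ftop m) V" "U = V \<inter> Tight m"
    by (auto simp: Ttop_def openin_subtopology)
  then show ?R
    unfolding openin_Ftop_iff by blast
next
  assume R: ?R
  have "\<exists>V. openin (Ttop m) V \<and> F \<in> V \<and> V \<subseteq> U" if "F \<in> U" for F
  proof -
    obtain x X where "x \<in> E" "finite X" "X \<subseteq> E" "F \<in> Vfilt m x X" "Vfilt m x X \<inter> Tight m \<subseteq> U"
      using R \<open>F \<in> U\<close> by blast
    moreover from this have "openin (Ttop m) (Vfilt m x X \<inter> Tight m)"
      unfolding Ttop_def openin_subtopology using openin_Vfilt by blast
    ultimately show ?thesis using R \<open>F \<in> U\<close> by blast
  qed
  then show "openin (Ttop m) U"
    by (subst openin_subopen) blast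
qed

lemma openin_Vt: "x \<in> E \<Longrightarrow> openin (Ttop m) (Vt m x)"
  unfolding openin_Ttop_iff
  by (auto simp: Vt_def Vfilt_def Tight_Filt intro!: exI[of _ x] exI[of _ "{}"])

text \<open>Basic sets pull back to basic sets. Both the invariance of tight filters and the
  continuity of the action rest on this.\<close>

lemma theta_mem_Vfilt_iff:
  assumes F: "F \<in> Filt m" and s: "s\<^sup>\<star> \<cdot> s \<in> F" and x: "x \<in> E" and X: "X \<subseteq> E"
  shows "theta m s F \<in> Vfilt m x X \<longleftrightarrow> F \<in> Vfilt m (s\<^sup>\<star> \<cdot> x \<cdot> s) ((\<lambda>y. s\<^sup>\<star> \<cdot> y \<cdot> s) ` X)"
  using assms theta_Filt[OF F s] by (auto simp: Vfilt_def mem_theta_iff disjoint_iff)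

text \<open>Every filter in a pulled-back basic set thus lies automatically in the domain of
  \<open>theta m s\<close>.\<close>

lemma dom_mem_of_conj_mem:
  assumes F: "F \<in> Filt m" and x: "x \<in> E" and s: "s\<^sup>\<star> \<cdot> x \<cdot> s \<in> F"
  shows "s\<^sup>\<star> \<cdot> s \<in> F"
proof -
  have "s\<^sup>\<star> \<cdot> x \<cdot> s \<preceq> s\<^sup>\<star> \<cdot> s"
    by (simp add: leqE_def assoc)
  then show ?thesis
    using Filt_up[OF F s] by simp
qed

text \<open>A basic neighbourhood of the image is pulled back, tightness of \<open>F\<close>
  provides an ultrafilter there, and \<open>theta\<close> pushes that ultrafilter forward.\<close>

lemma theta_Tight:
  assumes F: "F \<in> Tight m" and s: "s\<^sup>\<star> \<cdot> s \<in> F"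
  shows "theta m s F \<in> Tight m"
  unfolding Tight_iff
proof (intro conjI allI impI)
  note FF = Tight_Filt[OF F]
  show "theta m s F \<in> Filt m"
    by (rule theta_Filt[OF FF s])
  fix x X assume h: "x \<in> E \<and> finite X \<and> X \<subseteq> E \<and> theta m s F \<in> Vfilt m x X"
  let ?X = "(\<lambda>y. s\<^sup>\<star> \<cdot> y \<cdot> s) ` X"
  have "F \<in> Vfilt m (s\<^sup>\<star> \<cdot> x \<cdot> s) ?X"
    using h theta_mem_Vfilt_iff[OF FF s] by blast
  moreover have "?X \<subseteq> E" "finite ?X" "s\<^sup>\<star> \<cdot> x \<cdot> s \<in> E"
    using h by auto
  ultimately obtain U where U: "U \<in> Ultra m" "U \<in> Vfilt m (s\<^sup>\<star> \<cdot> x \<cdot> s) ?X"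
    using F unfolding Tight_iff by blast
  have UF: "U \<in> Filt m" "s\<^sup>\<star> \<cdot> s \<in> U"
    using U h dom_mem_of_conj_mem[of U x s] by (auto simp: Vfilt_def)
  have "theta m s U \<in> Vfilt m x X"
    using theta_mem_Vfilt_iff[OF UF] h U by blast
  then show "Ultra m \<inter> Vfilt m x X \<noteq> {}"
    using theta_Ultra[OF U(1) UF(2)] by blast
qed

text \<open>Continuity of the action on its open domain. Used with \<open>s\<close> it makes slices
  open; used with \<open>s\<^sup>\<star>\<close> it makes images under \<open>theta m s\<close>
  open, which gives the continuity of \<open>tau\<close>.\<close>

lemma openin_theta_vimage:
  assumes U: "openin (Ttop m) U"
  shows "openin (Ttop m) {F \<in> Vt m (s\<^sup>\<star> \<cdot> s). theta m s F \<in> U}"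
  unfolding openin_Ttop_iff
proof (intro conjI ballI)
  show "{F \<in> Vt m (s\<^sup>\<star> \<cdot> s). theta m s F \<in> U} \<subseteq> Tight m"
    by (auto simp: Vt_def)
  fix F assume "F \<in> {F \<in> Vt m (s\<^sup>\<star> \<cdot> s). theta m s F \<in> U}"
  then have F: "F \<in> Tight m" "F \<in> Filt m" "s\<^sup>\<star> \<cdot> s \<in> F" "theta m s F \<in> U"
    by (auto simp: Vt_def Tight_Filt)
  then obtain x X where h: "x \<in> E" "finite X" "X \<subseteq> E" "theta m s F \<in> Vfilt m x X"
    "Vfilt m x X \<inter> Tight m \<subseteq> U"
    using U unfolding openin_Ttop_iff by blast
  let ?X = "(\<lambda>y. s\<^sup>\<star> \<cdot> y \<cdot> s) ` X"
  have "F' \<in> {F \<in> Vt m (s\<^sup>\<star> \<cdot> s). theta m s F \<in> U}"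
    if F': "F' \<in> Vfilt m (s\<^sup>\<star> \<cdot> x \<cdot> s) ?X" "F' \<in> Tight m" for F'
  proof -
    have F'2: "F' \<in> Filt m" "s\<^sup>\<star> \<cdot> s \<in> F'"
      using F' h dom_mem_of_conj_mem[of F' x s] by (auto simp: Vfilt_def)
    then have "theta m s F' \<in> Vfilt m x X"
      using theta_mem_Vfilt_iff h F' by blast
    then show ?thesis
      using F'2 F' theta_Tight[of F' s] h(5) by (auto simp: Vt_def)
  qed
  moreover have "F \<in> Vfilt m (s\<^sup>\<star> \<cdot> x \<cdot> s) ?X"
    using theta_mem_Vfilt_iff[OF F(2,3) h(1,3)] h(4) by blast
  ultimately show "\<exists>x X. x \<in> E \<and> finite X \<and> X \<subseteq> E \<and> F \<in> Vfilt m x X \<and>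
      Vfilt m x X \<inter> Tight m \<subseteq> {F \<in> Vt m (s\<^sup>\<star> \<cdot> s). theta m s F \<in> U}"
    using h by (intro exI[of _ "s\<^sup>\<star> \<cdot> x \<cdot> s"] exI[of _ ?X]) auto
qed

section \<open>Germs\<close>

lemma mem_germ_iff:
  "p \<in> germ m s F \<longleftrightarrow> snd p = F \<and> (fst p)\<^sup>\<star> \<cdot> fst p \<in> F \<and> (\<exists>e\<in>F. s \<cdot> e = fst p \<cdot> e)"
  by (auto simp: germ_def)

lemma germ_subset:
  assumes F: "F \<in> Filt m" and e: "e \<in> F" "s \<cdot> e = t \<cdot> e"
  shows "germ m s F \<subseteq> germ m t F"
proof
  fix p assume "p \<in> germ m s F"
  then obtain e' where p: "snd p = F" "(fst p)\<^sup>\<star> \<cdot> fst p \<in> F" "e' \<in> F" "s \<cdot> e' = fst p \<cdot> e'"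
    by (auto simp: mem_germ_iff)
  have "t \<cdot> (e \<cdot> e') = s \<cdot> (e \<cdot> e')"
    using e(2) by (simp flip: assoc)
  also have "\<dots> = s \<cdot> e' \<cdot> e"
    using E_commute[of e e'] e(1) p(3) Filt_E[OF F] by (simp add: assoc)
  also have "\<dots> = fst p \<cdot> (e \<cdot> e')"
    using E_commute[of e e'] e(1) p(3,4) Filt_E[OF F] by (simp add: assoc)
  finally show "p \<in> germ m t F"
    using p Filt_multI[OF F e(1) p(3)] by (auto simp: mem_germ_iff)
qed

lemma germ_eqI:
  assumes "F \<in> Filt m" "e \<in> F" "s \<cdot> e = t \<cdot> e"
  shows "germ m s F = germ m t F"
  using germ_subset[of F e s t] germ_subset[of F e t s] assms by auto

lemma germ_self: "s\<^sup>\<star> \<cdot> s \<in> F \<Longrightarrow> (s, F) \<in> germ m s F"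
  by (auto simp: mem_germ_iff)

text \<open>The chosen representative \<open>t\<close> may differ from \<open>s\<close>, but the two
  agree after multiplication by some \<open>e\<close> in the filter. Whatever depends only on such
  products is independent of the choice.\<close>

lemma grep_germ:
  assumes "s\<^sup>\<star> \<cdot> s \<in> F"
  obtains t e where "grep (germ m s F) = (t, F)" "t\<^sup>\<star> \<cdot> t \<in> F" "e \<in> F" "s \<cdot> e = t \<cdot> e"
proof -
  have "grep (germ m s F) \<in> germ m s F"
    unfolding grep_def by (rule someI[of _ "(s, F)"]) (rule germ_self[OF assms])
  then show ?thesis
    using that by (cases "grep (germ m s F)") (auto simp: mem_germ_iff)
qed

lemma theta_cong:
  assumes F: "F \<in> Filt m" and s: "s\<^sup>\<star> \<cdot> s \<in> F" and t: "t\<^sup>\<star> \<cdot> t \<in> F"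
    and e: "e \<in> F" "s \<cdot> e = t \<cdot> e"
  shows "theta m s F = theta m t F"
proof -
  \<comment> \<open>As \<open>e\<close> belongs to \<open>F\<close>, membership of the conjugate
    depends on \<open>u\<close> only through \<open>u \<cdot> e\<close>.\<close>
  have *: "u\<^sup>\<star> \<cdot> f \<cdot> u \<in> F \<longleftrightarrow> (u \<cdot> e)\<^sup>\<star> \<cdot> f \<cdot> (u \<cdot> e) \<in> F" if "f \<in> E" for u f
  proof -
    have eE: "e \<in> E"
      using F e(1) Filt_E by blast
    have "(u \<cdot> e)\<^sup>\<star> \<cdot> f \<cdot> (u \<cdot> e) = e \<cdot> (u\<^sup>\<star> \<cdot> f \<cdot> u) \<cdot> e"
      using eE by (simp add: sinv_mult assoc)
    then show ?thesis
      using Filt_mult[OF F] eE e(1) that by simp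
  qed
  have "f \<in> theta m s F \<longleftrightarrow> f \<in> theta m t F" for f
    using *[of f s] *[of f t] e(2) by (auto simp: mem_theta_iff[OF F s] mem_theta_iff[OF F t])
  then show ?thesis by blast
qed

lemma grng_germ:
  assumes F: "F \<in> Filt m" and s: "s\<^sup>\<star> \<cdot> s \<in> F"
  shows "grng m (germ m s F) = theta m s F"
proof -
  obtain t e where t: "grep (germ m s F) = (t, F)" "t\<^sup>\<star> \<cdot> t \<in> F" "e \<in> F" "s \<cdot> e = t \<cdot> e"
    by (rule grep_germ[OF s])
  then show ?thesis
    using theta_cong[OF F s t(2-4)] by (simp add: grng_def)
qed

lemma germ_in_Gtight: "F \<in> Tight m \<Longrightarrow> s\<^sup>\<star> \<cdot> s \<in> F \<Longrightarrow> germ m s F \<in> Gtight m"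
  by (auto simp: Gtight_def)

text \<open>Writing each germ through its own chosen representative lets \<open>gsrc\<close>,
  \<open>grng\<close> and \<open>gmul\<close> unfold without a new appeal to independence of
  choices.\<close>

lemma Gtight_grep:
  assumes "\<gamma> \<in> Gtight m"
  obtains s F where "grep \<gamma> = (s, F)" "F \<in> Tight m" "s\<^sup>\<star> \<cdot> s \<in> F" "\<gamma> = germ m s F"
proof -
  obtain s F where s: "\<gamma> = germ m s F" "F \<in> Tight m" "s\<^sup>\<star> \<cdot> s \<in> F"
    using assms by (auto simp: Gtight_def)
  obtain t e where t: "grep (germ m s F) = (t, F)" "t\<^sup>\<star> \<cdot> t \<in> F" "e \<in> F" "s \<cdot> e = t \<cdot> e"
    by (rule grep_germ[OF s(3)])
  have "\<gamma> = germ m t F"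
    using s(1) germ_eqI[OF Tight_Filt[OF s(2)] t(3,4)] by simp
  then show ?thesis
    using that[of t F] t s by simp
qed

lemma grng_Tight: "\<gamma> \<in> Gtight m \<Longrightarrow> grng m \<gamma> \<in> Tight m"
  by (erule Gtight_grep) (simp add: grng_def theta_Tight)

lemma openin_germ_image:
  "openin (Ttop m) U \<Longrightarrow> U \<subseteq> Vt m (s\<^sup>\<star> \<cdot> s) \<Longrightarrow> openin (Gtop m) (germ m s ` U)"
  unfolding Gtop_def by (rule topology_generated_by_Basis) blast

lemma topspace_Gtop [simp]: "topspace (Gtop m) = Gtight m"
proof
  show "topspace (Gtop m) \<subseteq> Gtight m"
    unfolding Gtop_def topology_generated_by_topspace
    by (auto simp: Vt_def intro!: germ_in_Gtight)
  show "Gtight m \<subseteq> topspace (Gtop m)"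
  proof
    fix \<gamma> assume "\<gamma> \<in> Gtight m"
    then obtain s F where "\<gamma> = germ m s F" "F \<in> Tight m" "s\<^sup>\<star> \<cdot> s \<in> F"
      by (auto simp: Gtight_def)
    then have "\<gamma> \<in> germ m s ` Vt m (s\<^sup>\<star> \<cdot> s)"
      by (auto simp: Vt_def)
    then show "\<gamma> \<in> topspace (Gtop m)"
      using openin_subset[OF openin_germ_image[OF openin_Vt[OF E_dom[of s]]]] by blast
  qed
qed

end

section \<open>The grading on germs\<close>

locale purely_graded = inverse_semigroup m z
  for m :: "'a \<Rightarrow> 'a \<Rightarrow> 'a" (infixl "\<cdot>" 70) and z :: 'a +
  fixes G :: "('g, 'b) monoid_scheme" and \<phi> :: "'a \<Rightarrow> 'g"
  assumes group: "group G" and pure_grading: "pure_grading m z G \<phi>"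

sublocale purely_graded \<subseteq> grp: group G
  by (rule group)

context purely_graded
begin

abbreviation ginv :: "'g \<Rightarrow> 'g" where "ginv g \<equiv> inv\<^bsub>G\<^esub> g"

lemma phi_closed [simp]: "s \<noteq> z \<Longrightarrow> \<phi> s \<in> carrier G"
  and phi_mult: "a \<cdot> b \<noteq> z \<Longrightarrow> \<phi> (a \<cdot> b) = \<phi> a \<otimes>\<^bsub>G\<^esub> \<phi> b"
  using pure_grading by (auto simp: pure_grading_def)

lemma phi_one_iff: "s \<noteq> z \<Longrightarrow> \<phi> s = \<one>\<^bsub>G\<^esub> \<longleftrightarrow> s \<in> E"
  using pure_grading unfolding pure_grading_def by blast

lemma dom_nonzero_iff [simp]: "s\<^sup>\<star> \<cdot> s = z \<longleftrightarrow> s = z"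
  by (metis sinv_cancel(1) zero_right)

lemma star_nonzero_iff [simp]: "s\<^sup>\<star> = z \<longleftrightarrow> s = z"
  by (metis sinv_cancel(2) sinv_sinv zero_left zero_right)

lemma phi_star:
  assumes "s \<noteq> z"
  shows "\<phi> (s\<^sup>\<star>) = ginv (\<phi> s)"
proof -
  have "\<phi> (s\<^sup>\<star>) \<otimes>\<^bsub>G\<^esub> \<phi> s = \<one>\<^bsub>G\<^esub>"
    using phi_mult[of "s\<^sup>\<star>" s] phi_one_iff[of "s\<^sup>\<star> \<cdot> s"] assms by simp
  then show ?thesis
    using assms by (simp add: grp.inv_equality)
qed

text \<open>Purity of the grading enters here: \<open>s \<cdot> x \<cdot> t\<^sup>\<star>\<close> has trivial degree, hence is idempotent.\<close>

lemma eq_of_phi_eq: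
  assumes s: "s \<noteq> z" and t: "t \<noteq> z" and st: "\<phi> s = \<phi> t" and x: "x \<in> E"
    and xs: "x \<preceq> s\<^sup>\<star> \<cdot> s" and xt: "x \<preceq> t\<^sup>\<star> \<cdot> t"
  shows "s \<cdot> x = t \<cdot> x"
proof (cases "x = z")
  \<comment> \<open>The grading says nothing about the value of \<open>\<phi>\<close> at
    \<open>z\<close>, so degrees can be computed only for nonzero products.\<close>
  case False
  have xs': "x \<cdot> (s\<^sup>\<star> \<cdot> s) = x" and xt': "x \<cdot> (t\<^sup>\<star> \<cdot> t) = x"
    using xs xt by (simp_all add: leqD)
  have xs'': "s\<^sup>\<star> \<cdot> (s \<cdot> x) = x" and xt'': "t\<^sup>\<star> \<cdot> (t \<cdot> x) = x"
    using xs' xt' E_commute[OF x E_dom] by (simp_all add: assoc)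
  define e where "e = s \<cdot> x \<cdot> t\<^sup>\<star>"
  have et: "e \<cdot> t = s \<cdot> x"
    using xt' by (simp add: e_def assoc)
  have nz: "s \<cdot> x \<noteq> z" "e \<noteq> z"
    using False xs'' et by (metis zero_left zero_right)+
  have "\<phi> e = \<phi> s \<otimes>\<^bsub>G\<^esub> \<phi> x \<otimes>\<^bsub>G\<^esub> \<phi> (t\<^sup>\<star>)"
    using nz phi_mult[of "s \<cdot> x" "t\<^sup>\<star>"] phi_mult[of s x] by (simp add: e_def)
  also have "\<dots> = \<one>\<^bsub>G\<^esub>"
    using phi_one_iff[OF False] x s t st by (simp add: phi_star)
  finally have eE: "e \<in> E"
    using phi_one_iff nz by blast
  \<comment> \<open>The source idempotent of \<open>s \<cdot> x = e \<cdot> t\<close>, computed in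
    two ways, expresses \<open>x\<close> by \<open>e\<close> and \<open>t\<close>. Multiplying by
    \<open>t\<close> on the left then gives \<open>e \<cdot> t\<close>, because \<open>e\<close>
    commutes with the range idempotent of \<open>t\<close>.\<close>
  have "x = (s \<cdot> x)\<^sup>\<star> \<cdot> (s \<cdot> x)"
    using x xs'' by (simp add: sinv_mult assoc E_idem)
  also have "\<dots> = (e \<cdot> t)\<^sup>\<star> \<cdot> (e \<cdot> t)"
    by (simp only: et)
  also have "\<dots> = t\<^sup>\<star> \<cdot> e \<cdot> t"
    using eE by (simp add: sinv_mult assoc E_idem_left)
  finally have "t \<cdot> x = t \<cdot> (t\<^sup>\<star> \<cdot> (e \<cdot> t))"
    by (simp add: assoc)
  also have "\<dots> = e \<cdot> t"
    using eE commute_ran_left[of e t t] by simp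
  finally show ?thesis
    using et by simp
qed simp

lemma dom_mem_nonzero: "F \<in> Filt m \<Longrightarrow> s\<^sup>\<star> \<cdot> s \<in> F \<Longrightarrow> s \<noteq> z"
  using Filt_zero by force

section \<open>The partial action expressed by semigroup elements\<close>

lemma EgrI: "s \<noteq> z \<Longrightarrow> x \<in> E \<Longrightarrow> x \<preceq> s \<cdot> s\<^sup>\<star> \<Longrightarrow> x \<in> Egr m z \<phi> (\<phi> s)"
  by (auto simp: Egr_def)

text \<open>Filters are upward closed, so the elements of \<open>Egr\<close> can be replaced by the
  range idempotents above them. The default value \<open>{z}\<close> of \<open>Egr\<close>
  contributes nothing, since no filter contains \<open>z\<close>.\<close>

lemma mem_Dg_iff:
  "F \<in> Dg m z \<phi> g \<longleftrightarrow> F \<in> Tight m \<and> (\<exists>s. s \<noteq> z \<and> \<phi> s = g \<and> s \<cdot> s\<^sup>\<star> \<in> F)"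
proof
  assume "F \<in> Dg m z \<phi> g"
  then obtain x where x: "x \<in> Egr m z \<phi> g" "x \<in> F" and F: "F \<in> Tight m"
    by (auto simp: Dg_def Vt_def)
  have "x \<noteq> z"
    using x F Filt_zero Tight_Filt by blast
  then obtain s where "s \<noteq> z" "\<phi> s = g" "x \<preceq> s \<cdot> s\<^sup>\<star>"
    using x(1) by (auto simp: Egr_def split: if_splits)
  then show "F \<in> Tight m \<and> (\<exists>s. s \<noteq> z \<and> \<phi> s = g \<and> s \<cdot> s\<^sup>\<star> \<in> F)"
    using F x(2) Filt_up[OF Tight_Filt[OF F]] E_ran by blast
next
  assume "F \<in> Tight m \<and> (\<exists>s. s \<noteq> z \<and> \<phi> s = g \<and> s \<cdot> s\<^sup>\<star> \<in> F)"
  then obtain s where s: "F \<in> Tight m" "s \<noteq> z" "\<phi> s = g" "s \<cdot> s\<^sup>\<star> \<in> F"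
    by blast
  then have "s \<cdot> s\<^sup>\<star> \<in> Egr m z \<phi> g"
    using EgrI[of s "s \<cdot> s\<^sup>\<star>"] by simp
  then show "F \<in> Dg m z \<phi> g"
    using s by (auto simp: Dg_def Vt_def)
qed

lemma DgI: "F \<in> Tight m \<Longrightarrow> s \<cdot> s\<^sup>\<star> \<in> F \<Longrightarrow> F \<in> Dg m z \<phi> (\<phi> s)"
  unfolding mem_Dg_iff using dom_mem_nonzero[of F "s\<^sup>\<star>"] Tight_Filt by auto

lemma Dg_Tight: "F \<in> Dg m z \<phi> g \<Longrightarrow> F \<in> Tight m"
  by (simp add: mem_Dg_iff)

lemma openin_Dg: "openin (Ttop m) (Dg m z \<phi> g)"
  unfolding Dg_def by (rule openin_Union) (auto simp: Egr_def intro!: openin_Vt split: if_splits)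

text \<open>The element chosen in \<open>phig\<close> agrees with \<open>s\<close> below
  \<open>x\<close> by purity, and the conjugate of \<open>x\<close> by \<open>u\<close> depends only
  on \<open>u \<cdot> x\<close>.\<close>

lemma phig_eq:
  assumes s: "s \<noteq> z" "\<phi> s = g" and x: "x \<in> E" "x \<preceq> s\<^sup>\<star> \<cdot> s"
  shows "phig m z \<phi> g x = s \<cdot> x \<cdot> s\<^sup>\<star>"
proof -
  define t where "t = (SOME s. s \<noteq> z \<and> \<phi> s = g \<and> x \<preceq> s\<^sup>\<star> \<cdot> s)"
  have t: "t \<noteq> z" "\<phi> t = g" "x \<preceq> t\<^sup>\<star> \<cdot> t"
    using someI[of "\<lambda>s. s \<noteq> z \<and> \<phi> s = g \<and> x \<preceq> s\<^sup>\<star> \<cdot> s" s] s x(2) unfolding t_def by auto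
  have eq: "t \<cdot> x = s \<cdot> x"
    using eq_of_phi_eq[OF t(1) s(1) _ x(1) t(3) x(2)] t(2) s(2) by simp
  have conj: "u \<cdot> x \<cdot> u\<^sup>\<star> = (u \<cdot> x) \<cdot> (u \<cdot> x)\<^sup>\<star>" for u
    using x(1) by (simp add: sinv_mult assoc E_idem_left)
  have "phig m z \<phi> g x = t \<cdot> x \<cdot> t\<^sup>\<star>"
    by (simp add: phig_def t_def Let_def)
  also have "\<dots> = s \<cdot> x \<cdot> s\<^sup>\<star>"
    using conj[of t] conj[of s] eq by simp
  finally show ?thesis .
qed

text \<open>The bridge between the two constructions: the partial action behind \<open>LR\<close>
  and the action behind the germs are the same map, whichever \<open>s\<close> of the given degree
  is used, as long as its domain idempotent lies in \<open>F\<close>.\<close>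

lemma hg_eq:
  assumes F: "F \<in> Filt m" and s: "s\<^sup>\<star> \<cdot> s \<in> F"
  shows "hg m z G \<phi> (\<phi> s) F = theta m s F"
proof (rule Set.set_eqI, rule iffI)
  have nz: "s \<noteq> z"
    by (rule dom_mem_nonzero[OF F s])
  fix y
  {
    assume "y \<in> hg m z G \<phi> (\<phi> s) F"
    then obtain x where y: "y \<in> E" and x: "x \<in> F" "x \<in> Egr m z \<phi> (ginv (\<phi> s))"
      and le: "phig m z \<phi> (\<phi> s) x \<preceq> y"
      by (auto simp: hg_def)
    have xE: "x \<in> E" "x \<noteq> z"
      using x F Filt_E Filt_zero by blast+
    then obtain t where t: "t \<noteq> z" "\<phi> t = ginv (\<phi> s)" "x \<preceq> t \<cdot> t\<^sup>\<star>"
      using x(2) by (auto simp: Egr_def split: if_splits)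
    have t': "t\<^sup>\<star> \<noteq> z" "\<phi> (t\<^sup>\<star>) = \<phi> s" "x \<preceq> t\<^sup>\<star>\<^sup>\<star> \<cdot> t\<^sup>\<star>"
      using t nz by (simp_all add: phi_star)
    \<comment> \<open>The element \<open>x\<close> need not lie below the domain idempotent of
      \<open>s\<close>. Its restriction \<open>x'\<close> is below the domains of both
      \<open>s\<close> and \<open>t\<^sup>\<star>\<close>, so \<open>phig\<close> can be computed
      there with either.\<close>
    define x' where "x' = x \<cdot> (s\<^sup>\<star> \<cdot> s)"
    have x': "x' \<in> E" "x' \<in> F" "x' \<preceq> x" "x' \<preceq> s\<^sup>\<star> \<cdot> s"
      using xE x s F by (simp_all add: x'_def Filt_multI leq_mult_left leq_mult_right)
    have "s \<cdot> x' \<cdot> s\<^sup>\<star> = phig m z \<phi> (\<phi> s) x'"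
      using phig_eq[OF nz _ x'(1,4)] by simp
    also have "\<dots> = t\<^sup>\<star> \<cdot> x' \<cdot> t\<^sup>\<star>\<^sup>\<star>"
      using phig_eq[OF t'(1,2) x'(1) leq_trans[OF x'(3) t'(3)]] .
    also have "\<dots> \<preceq> t\<^sup>\<star> \<cdot> x \<cdot> t\<^sup>\<star>\<^sup>\<star>"
      using conj'_mono[OF x'(1) xE(1) x'(3)] .
    also have "t\<^sup>\<star> \<cdot> x \<cdot> t\<^sup>\<star>\<^sup>\<star> = phig m z \<phi> (\<phi> s) x"
      using phig_eq[OF t'(1,2) xE(1) t'(3)] by simp
    finally have "s \<cdot> x' \<cdot> s\<^sup>\<star> \<preceq> y"
      using le leq_trans by blast
    then show "y \<in> theta m s F"
      using y x'(2) by (auto simp: theta_def)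
  next
    assume "y \<in> theta m s F"
    then obtain e where e: "y \<in> E" "e \<in> F" "s \<cdot> e \<cdot> s\<^sup>\<star> \<preceq> y"
      by (auto simp: theta_def)
    have eE: "e \<in> E"
      using e F Filt_E by blast
    \<comment> \<open>Cutting \<open>e\<close> down to the domain of \<open>s\<close> leaves its
      conjugate by \<open>s\<close> unchanged and puts it into the domain of
      \<open>phig\<close>.\<close>
    define x where "x = e \<cdot> (s\<^sup>\<star> \<cdot> s)"
    have x: "x \<in> E" "x \<in> F" "x \<preceq> s\<^sup>\<star> \<cdot> s"
      using eE e s F by (simp_all add: x_def Filt_multI leq_mult_right)
    have "x \<in> Egr m z \<phi> (ginv (\<phi> s))"
      using EgrI[of "s\<^sup>\<star>" x] x nz by (simp add: phi_star)
    moreover have "phig m z \<phi> (\<phi> s) x = s \<cdot> e \<cdot> s\<^sup>\<star>"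
      using phig_eq[OF nz _ x(1,3)] by (simp add: x_def assoc)
    ultimately show "y \<in> hg m z G \<phi> (\<phi> s) F"
      using e x unfolding hg_def by (intro CollectI conjI bexI[of _ x]) simp_all
  }
qed

definition grade :: "('a \<times> 'a set) set \<Rightarrow> 'g" where
  "grade \<gamma> = \<phi> (fst (grep \<gamma>))"

text \<open>Multiplication by an idempotent preserves the degree of \<open>s\<close> as long as the
  product is nonzero. Here \<open>s \<cdot> e\<close> is nonzero because
  \<open>s\<^sup>\<star> \<cdot> (s \<cdot> e)\<close> belongs to the filter.\<close>

lemma grade_germ:
  assumes F: "F \<in> Filt m" and s: "s\<^sup>\<star> \<cdot> s \<in> F"
  shows "grade (germ m s F) = \<phi> s"
proof -
  obtain t e where t: "grep (germ m s F) = (t, F)" "t\<^sup>\<star> \<cdot> t \<in> F" "e \<in> F" "s \<cdot> e = t \<cdot> e"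
    by (rule grep_germ[OF s])
  have e: "e \<in> E" "e \<noteq> z"
    using F t(3) Filt_E Filt_zero by blast+
  have "s\<^sup>\<star> \<cdot> (s \<cdot> e) \<in> F"
    using Filt_multI[OF F s t(3)] by (simp add: assoc)
  then have nz: "s \<cdot> e \<noteq> z"
    using Filt_zero[OF F] by (metis zero_right)
  have "\<phi> s = \<phi> (s \<cdot> e)"
    using phi_mult[OF nz] phi_one_iff[OF e(2)] e(1) dom_mem_nonzero[OF F s] by simp
  also have "\<dots> = \<phi> t"
    using phi_mult[of t e] nz t(4) phi_one_iff[OF e(2)] e(1) dom_mem_nonzero[OF F t(2)] by simp
  finally show ?thesis
    by (simp add: grade_def t(1))
qed

section \<open>Germs parametrised by their degree and one endpoint\<close>

lemma Gtight_cases: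
  assumes "\<gamma> \<in> Gtight m"
  obtains s F where "\<gamma> = germ m s F" "F \<in> Tight m" "F \<in> Filt m" "s\<^sup>\<star> \<cdot> s \<in> F" "s \<noteq> z"
    "grade \<gamma> = \<phi> s" "gsrc \<gamma> = F" "grng m \<gamma> = theta m s F" "grep \<gamma> = (s, F)"
proof -
  obtain s F where s: "grep \<gamma> = (s, F)" "F \<in> Tight m" "s\<^sup>\<star> \<cdot> s \<in> F" "\<gamma> = germ m s F"
    by (rule Gtight_grep[OF assms])
  then show ?thesis
    using that[of s F] Tight_Filt[OF s(2)] dom_mem_nonzero[of F s]
    by (simp add: grade_def gsrc_def grng_def)
qed

lemma grade_closed: "\<gamma> \<in> Gtight m \<Longrightarrow> grade \<gamma> \<in> carrier G"
  by (erule Gtight_cases) simp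

lemma grng_Dg: "\<gamma> \<in> Gtight m \<Longrightarrow> grng m \<gamma> \<in> Dg m z \<phi> (grade \<gamma>)"
  by (erule Gtight_cases) (simp add: DgI theta_Tight ran_mem_theta)

lemma gsrc_eq:
  assumes "\<gamma> \<in> Gtight m"
  shows "gsrc \<gamma> = hg m z G \<phi> (ginv (grade \<gamma>)) (grng m \<gamma>)"
proof -
  obtain s F where s: "F \<in> Filt m" "s\<^sup>\<star> \<cdot> s \<in> F" "s \<noteq> z"
    "grade \<gamma> = \<phi> s" "gsrc \<gamma> = F" "grng m \<gamma> = theta m s F"
    by (rule Gtight_cases[OF assms])
  then show ?thesis
    using hg_eq[OF theta_Filt[OF s(1,2)], of "s\<^sup>\<star>"] ran_mem_theta[OF s(1,2)] theta_inverse[OF s(1,2)]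
    by (simp add: phi_star)
qed

lemma grng_eq:
  assumes "\<gamma> \<in> Gtight m"
  shows "grng m \<gamma> = hg m z G \<phi> (grade \<gamma>) (gsrc \<gamma>)"
  by (rule Gtight_cases[OF assms]) (simp add: hg_eq)

lemma gsrc_Dg: "\<gamma> \<in> Gtight m \<Longrightarrow> gsrc \<gamma> \<in> Dg m z \<phi> (ginv (grade \<gamma>))"
proof (erule Gtight_cases)
  fix s F assume s: "F \<in> Tight m" "s\<^sup>\<star> \<cdot> s \<in> F" "s \<noteq> z" "grade \<gamma> = \<phi> s" "gsrc \<gamma> = F"
  then show ?thesis
    using DgI[of F "s\<^sup>\<star>"] by (simp add: phi_star)
qed

text \<open>The product of the two domain idempotents lies in the common source filter, and below it
  the representatives coincide by purity.\<close>

lemma Gtight_eqI_src: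
  assumes \<gamma>: "\<gamma> \<in> Gtight m" and \<delta>: "\<delta> \<in> Gtight m" and gr: "grade \<gamma> = grade \<delta>"
    and src: "gsrc \<gamma> = gsrc \<delta>"
  shows "\<gamma> = \<delta>"
proof -
  obtain s F where s: "\<gamma> = germ m s F" "F \<in> Filt m" "s\<^sup>\<star> \<cdot> s \<in> F" "s \<noteq> z"
    "grade \<gamma> = \<phi> s" "gsrc \<gamma> = F"
    by (rule Gtight_cases[OF \<gamma>])
  obtain t F' where t: "\<delta> = germ m t F'" "t\<^sup>\<star> \<cdot> t \<in> F'" "t \<noteq> z" "grade \<delta> = \<phi> t" "gsrc \<delta> = F'"
    by (rule Gtight_cases[OF \<delta>])
  have F': "F' = F"
    using s t src by simp
  define e where "e = (s\<^sup>\<star> \<cdot> s) \<cdot> (t\<^sup>\<star> \<cdot> t)"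
  have "e \<in> F"
    using s t F' by (simp add: e_def Filt_multI)
  moreover have "s \<cdot> e = t \<cdot> e"
    using s t gr by (intro eq_of_phi_eq) (simp_all add: e_def leq_mult_left leq_mult_right)
  ultimately show ?thesis
    using germ_eqI[of F e s t] s t F' by simp
qed

lemma Gtight_eqI_rng:
  assumes "\<gamma> \<in> Gtight m" "\<delta> \<in> Gtight m" "grade \<gamma> = grade \<delta>" "grng m \<gamma> = grng m \<delta>"
  shows "\<gamma> = \<delta>"
  using assms by (intro Gtight_eqI_src) (simp_all add: gsrc_eq)

text \<open>The germ is that of any \<open>s\<close> of degree \<open>g\<close> whose range
  idempotent lies in \<open>F\<close>, taken at the filter obtained by carrying \<open>F\<close>
  back along \<open>s\<^sup>\<star>\<close>.\<close>

lemma Gtight_surj: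
  assumes F: "F \<in> Dg m z \<phi> g"
  shows "\<exists>\<gamma>\<in>Gtight m. grade \<gamma> = g \<and> grng m \<gamma> = F"
proof -
  obtain s where s: "F \<in> Tight m" "F \<in> Filt m" "s \<noteq> z" "\<phi> s = g" "s\<^sup>\<star>\<^sup>\<star> \<cdot> s\<^sup>\<star> \<in> F"
    using F Tight_Filt by (auto simp: mem_Dg_iff)
  define F' where "F' = theta m (s\<^sup>\<star>) F"
  have F': "F' \<in> Tight m" "F' \<in> Filt m" "s\<^sup>\<star> \<cdot> s \<in> F'" "theta m s F' = F"
    using theta_Tight[OF s(1,5)] theta_Filt[OF s(2,5)] ran_mem_theta[OF s(2,5)]
      theta_inverse[OF s(2,5)] by (simp_all add: F'_def)
  then show ?thesis
    using s by (intro bexI[of _ "germ m s F'"]) (simp_all add: grade_germ grng_germ germ_in_Gtight)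
qed

text \<open>\<open>tau g F\<close> is the unique germ of degree \<open>g\<close> with range \<open>F\<close>; it is a junk value unless
  \<open>F \<in> Dg m z \<phi> g\<close>.\<close>

definition tau :: "'g \<Rightarrow> 'a set \<Rightarrow> ('a \<times> 'a set) set" where
  "tau g F = (SOME \<gamma>. \<gamma> \<in> Gtight m \<and> grade \<gamma> = g \<and> grng m \<gamma> = F)"

lemma tau:
  assumes "F \<in> Dg m z \<phi> g"
  shows "tau g F \<in> Gtight m" "grade (tau g F) = g" "grng m (tau g F) = F"
  using someI_ex[of "\<lambda>\<gamma>. \<gamma> \<in> Gtight m \<and> grade \<gamma> = g \<and> grng m \<gamma> = F"] Gtight_surj[OF assms]
  unfolding tau_def by auto

lemma tau_eq: "\<gamma> \<in> Gtight m \<Longrightarrow> tau (grade \<gamma>) (grng m \<gamma>) = \<gamma>"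
  by (rule Gtight_eqI_rng) (simp_all add: tau grng_Dg)

lemma gmul:
  assumes \<alpha>: "\<alpha> \<in> Gtight m" and \<beta>: "\<beta> \<in> Gtight m" and comp: "gsrc \<alpha> = grng m \<beta>"
  shows "gmul m \<alpha> \<beta> \<in> Gtight m" "grade (gmul m \<alpha> \<beta>) = grade \<alpha> \<otimes>\<^bsub>G\<^esub> grade \<beta>"
    "grng m (gmul m \<alpha> \<beta>) = grng m \<alpha>"
proof -
  obtain s F where s: "s\<^sup>\<star> \<cdot> s \<in> F" "grade \<alpha> = \<phi> s" "gsrc \<alpha> = F" "grng m \<alpha> = theta m s F"
    "grep \<alpha> = (s, F)"
    by (rule Gtight_cases[OF \<alpha>])
  obtain t F' where t: "F' \<in> Tight m" "F' \<in> Filt m" "t\<^sup>\<star> \<cdot> t \<in> F'" "grade \<beta> = \<phi> t"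
    "grng m \<beta> = theta m t F'" "grep \<beta> = (t, F')"
    by (rule Gtight_cases[OF \<beta>])
  have F: "F = theta m t F'"
    using comp s t by simp
  have st: "(s \<cdot> t)\<^sup>\<star> \<cdot> (s \<cdot> t) \<in> F'" "theta m (s \<cdot> t) F' = theta m s F"
    using theta_mult[OF t(2,3)] s(1) F by simp_all
  have eq: "gmul m \<alpha> \<beta> = germ m (s \<cdot> t) F'"
    by (simp add: gmul_def s t)
  show "gmul m \<alpha> \<beta> \<in> Gtight m" "grng m (gmul m \<alpha> \<beta>) = grng m \<alpha>"
    using eq st s t by (simp_all add: germ_in_Gtight grng_germ)
  \<comment> \<open>Multiplicativity of \<open>\<phi>\<close> requires \<open>s \<cdot> t\<close> to
    be nonzero; its domain idempotent lies in \<open>F'\<close>, which excludes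
    \<open>z\<close>.\<close>
  show "grade (gmul m \<alpha> \<beta>) = grade \<alpha> \<otimes>\<^bsub>G\<^esub> grade \<beta>"
    using eq st s t dom_mem_nonzero[OF t(2) st(1)] by (simp add: grade_germ phi_mult)
qed

section \<open>The groupoid as a disjoint union of open subsets of the tight spectrum\<close>

text \<open>The copy of \<open>U \<inter> Dg m z \<phi> g\<close> inside the degree \<open>g\<close>
  part of the groupoid, with inverse maps \<open>tau g\<close> and \<open>grng m\<close>.\<close>

definition slice :: "'g \<Rightarrow> 'a set set \<Rightarrow> ('a \<times> 'a set) set set" where
  "slice g U = {\<gamma> \<in> Gtight m. grade \<gamma> = g \<and> grng m \<gamma> \<in> U}"

lemma openin_slice:
  assumes U: "openin (Ttop m) U"
  shows "openin (Gtop m) (slice g U)"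
proof -
  have "\<exists>W. openin (Gtop m) W \<and> \<gamma> \<in> W \<and> W \<subseteq> slice g U" if "\<gamma> \<in> slice g U" for \<gamma>
  proof -
    have \<gamma>: "\<gamma> \<in> Gtight m" "grade \<gamma> = g" "grng m \<gamma> \<in> U"
      using that by (auto simp: slice_def)
    obtain s F where s: "\<gamma> = germ m s F" "F \<in> Tight m" "s\<^sup>\<star> \<cdot> s \<in> F"
      "grade \<gamma> = \<phi> s" "grng m \<gamma> = theta m s F"
      by (rule Gtight_cases[OF \<gamma>(1)])
    let ?V = "{F \<in> Vt m (s\<^sup>\<star> \<cdot> s). theta m s F \<in> U}"
    have "openin (Gtop m) (germ m s ` ?V)"
      by (rule openin_germ_image[OF openin_theta_vimage[OF U]]) auto
    moreover have "\<gamma> \<in> germ m s ` ?V"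
      using s \<gamma> by (auto simp: Vt_def)
    moreover have "germ m s ` ?V \<subseteq> slice g U"
      using s(4) \<gamma>(2)
      by (auto simp: slice_def Vt_def germ_in_Gtight grade_germ grng_germ Tight_Filt)
    ultimately show ?thesis by blast
  qed
  then show ?thesis
    by (subst openin_subopen) blast
qed

lemma continuous_map_grng: "continuous_map (Gtop m) (Ttop m) (grng m)"
  unfolding continuous_map
proof (intro conjI allI impI)
  show "grng m ` topspace (Gtop m) \<subseteq> topspace (Ttop m)"
    by (auto simp: grng_Tight)
  fix U assume U: "openin (Ttop m) U"
  have "{\<gamma> \<in> topspace (Gtop m). grng m \<gamma> \<in> U} = (\<Union>g. slice g U)"
    by (auto simp: slice_def)
  then show "openin (Gtop m) {\<gamma> \<in> topspace (Gtop m). grng m \<gamma> \<in> U}"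
    using openin_slice[OF U] by auto
qed

text \<open>Checked on the generating sets of the germ topology. A set of germs of \<open>t\<close>
  has empty preimage unless \<open>t\<close> has degree \<open>g\<close>; otherwise its preimage is
  the set of ranges of these germs.\<close>

lemma continuous_map_tau: "continuous_map (subtopology (Ttop m) (Dg m z \<phi> g)) (Gtop m) (tau g)"
  (is "continuous_map ?X _ _")
proof -
  have top: "topspace ?X = Dg m z \<phi> g"
    using Dg_Tight by auto
  have "openin ?X (tau g -` W \<inter> topspace ?X)"
    if "W \<in> {germ m s ` U | s U. openin (Ttop m) U \<and> U \<subseteq> Vt m (s\<^sup>\<star> \<cdot> s)}" for W
  proof -
    obtain t U where W: "W = germ m t ` U" and U: "openin (Ttop m) U" "U \<subseteq> Vt m (t\<^sup>\<star> \<cdot> t)"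
      using \<open>W \<in> _\<close> by blast
    have germ: "germ m t F \<in> Gtight m" "grade (germ m t F) = \<phi> t" "grng m (germ m t F) = theta m t F"
      "F \<in> Filt m" "t\<^sup>\<star> \<cdot> t \<in> F" if "F \<in> U" for F
      using that U(2) Tight_Filt by (auto simp: Vt_def germ_in_Gtight grade_germ grng_germ)
    show ?thesis
    proof (cases "\<phi> t = g")
      case False
      have "tau g -` W \<inter> topspace ?X = {}"
        using False tau(2) germ(2) unfolding top W by force
      then show ?thesis by simp
    next
      case True
      \<comment> \<open>This is the image of \<open>U\<close> under \<open>theta m t\<close>,
        written as a preimage under the inverse map so that its openness is already known.\<close>
      let ?V = "{F \<in> Vt m (t\<^sup>\<star>\<^sup>\<star> \<cdot> t\<^sup>\<star>). theta m (t\<^sup>\<star>) F \<in> U}"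
      have "tau g -` W \<inter> topspace ?X = ?V"
      proof (intro equalityI subsetI)
        fix F assume "F \<in> tau g -` W \<inter> topspace ?X"
        then obtain F' where F': "F' \<in> U" "tau g F = germ m t F'" and F: "F \<in> Dg m z \<phi> g"
          unfolding top W by auto
        have "F = theta m t F'"
          using tau(3)[OF F] germ(3)[OF F'(1)] F'(2) by simp
        then show "F \<in> ?V"
          using Dg_Tight[OF F] F'(1) germ(4,5)[OF F'(1)] by (simp add: Vt_def ran_mem_theta theta_inverse)
      next
        fix F assume "F \<in> ?V"
        then have F: "F \<in> Tight m" "F \<in> Filt m" "t\<^sup>\<star>\<^sup>\<star> \<cdot> t\<^sup>\<star> \<in> F" "theta m (t\<^sup>\<star>) F \<in> U"
          using Tight_Filt by (auto simp: Vt_def)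
        have D: "F \<in> Dg m z \<phi> g"
          using DgI[OF F(1), of t] F(3) True by simp
        have "theta m t (theta m (t\<^sup>\<star>) F) = F"
          using theta_inverse[OF F(2,3)] by simp
        then have "tau g F = germ m t (theta m (t\<^sup>\<star>) F)"
          using tau[OF D] germ[OF F(4)] True by (intro Gtight_eqI_rng) simp_all
        then show "F \<in> tau g -` W \<inter> topspace ?X"
          using D F(4) unfolding top W by auto
      qed
      moreover have "openin (Ttop m) ?V"
        by (rule openin_theta_vimage[OF U(1)])
      moreover have "?V \<subseteq> Dg m z \<phi> g"
        using True DgI[of _ t] by (auto simp: Vt_def)
      ultimately show ?thesis
        by (metis openin_open_subtopology[OF openin_Dg])
    qed
  qed
  moreover have "tau g ` topspace ?X \<subseteq> \<Union>{germ m s ` U | s U. openin (Ttop m) U \<and> U \<subseteq> Vt m (s\<^sup>\<star> \<cdot> s)}"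
  proof -
    have "tau g ` topspace ?X \<subseteq> topspace (Gtop m)"
      unfolding top using tau(1) by auto
    then show ?thesis
      unfolding Gtop_def topology_generated_by_topspace .
  qed
  ultimately show ?thesis
    unfolding Gtop_def by (rule continuous_on_generated_topo)
qed

lemma slice_compact_open_bisection:
  assumes A: "A \<in> Tcg m z \<phi> g"
  shows "compact_open_bisection m (slice g A)"
  unfolding compact_open_bisection_def
proof (intro conjI)
  have A: "compactin (Ttop m) A" "openin (Ttop m) A" "A \<subseteq> Dg m z \<phi> g"
    using A by (auto simp: Tcg_def)
  have "slice g A = tau g ` A"
  proof (intro equalityI subsetI)
    fix \<gamma> assume "\<gamma> \<in> slice g A"
    then have "\<gamma> = tau g (grng m \<gamma>)" "grng m \<gamma> \<in> A"
      using tau_eq[of \<gamma>] by (auto simp: slice_def)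
    then show "\<gamma> \<in> tau g ` A" by blast
  next
    fix \<gamma> assume "\<gamma> \<in> tau g ` A"
    then show "\<gamma> \<in> slice g A"
      using tau A(3) by (auto simp: slice_def)
  qed
  moreover have "compactin (Gtop m) (tau g ` A)"
    using A by (intro image_compactin[OF _ continuous_map_tau]) (simp add: compactin_subtopology)
  ultimately show "compactin (Gtop m) (slice g A)"
    by simp
  show "openin (Gtop m) (slice g A)"
    by (rule openin_slice[OF A(2)])
  show "inj_on gsrc (slice g A)"
    using Gtight_eqI_src by (simp add: slice_def inj_on_def)
  show "inj_on (grng m) (slice g A)"
    using Gtight_eqI_rng by (simp add: slice_def inj_on_def)
qed

text \<open>Openness is continuity of \<open>tau g\<close>. For compactness, the degree
  \<open>g\<close> part is closed, its complement being the union of the open parts of other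
  degrees; so it meets \<open>B\<close> in a compact set, which \<open>grng\<close> projects onto
  the set in question.\<close>

lemma tau_vimage_Tcg:
  assumes B: "compactin (Gtop m) B" "openin (Gtop m) B"
  shows "{F \<in> Dg m z \<phi> g. tau g F \<in> B} \<in> Tcg m z \<phi> g" (is "?A \<in> _")
proof -
  have "openin (subtopology (Ttop m) (Dg m z \<phi> g))
      {F \<in> topspace (subtopology (Ttop m) (Dg m z \<phi> g)). tau g F \<in> B}"
    by (rule openin_continuous_map_preimage[OF continuous_map_tau B(2)])
  moreover have "{F \<in> topspace (subtopology (Ttop m) (Dg m z \<phi> g)). tau g F \<in> B} = ?A"
    using Dg_Tight by auto
  ultimately have op: "openin (Ttop m) ?A"
    by (simp add: openin_open_subtopology[OF openin_Dg])
  have sub: "slice g (Tight m) \<subseteq> topspace (Gtop m)"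
    by (auto simp: slice_def)
  have "topspace (Gtop m) - slice g (Tight m) = (\<Union>h\<in>-{g}. slice h (Tight m))"
    by (auto simp: slice_def grng_Tight)
  moreover have "openin (Gtop m) (\<Union>h\<in>-{g}. slice h (Tight m))"
    using openin_slice[OF openin_topspace[of "Ttop m"]] by (intro openin_Union) auto
  ultimately have "closedin (Gtop m) (slice g (Tight m))"
    using sub by (simp add: closedin_def)
  then have "compactin (Ttop m) (grng m ` (slice g (Tight m) \<inter> B))"
    by (rule image_compactin[OF closed_Int_compactin[OF _ B(1)] continuous_map_grng])
  moreover have "grng m ` (slice g (Tight m) \<inter> B) = ?A"
  proof (intro equalityI subsetI)
    fix F assume "F \<in> grng m ` (slice g (Tight m) \<inter> B)"
    then show "F \<in> ?A"
      using grng_Dg tau_eq by (auto simp: slice_def)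
  next
    fix F assume F: "F \<in> ?A"
    then have "tau g F \<in> slice g (Tight m) \<inter> B" "grng m (tau g F) = F"
      using tau[of F g] Dg_Tight[of F g] by (auto simp: slice_def)
    then show "F \<in> grng m ` (slice g (Tight m) \<inter> B)"
      by (metis imageI)
  qed
  ultimately show ?thesis
    using op by (auto simp: Tcg_def)
qed

text \<open>The parts of constant degree form an open cover, and a finite subcover bounds the
  degrees that occur.\<close>

lemma finite_grade_image:
  assumes B: "compactin (Gtop m) B"
  shows "finite (grade ` B)"
proof -
  have BG: "B \<subseteq> Gtight m"
    using compactin_subset_topspace[OF B] by simp
  have "B \<subseteq> \<Union>(range (\<lambda>g. slice g (Tight m)))"
    using BG by (auto simp: slice_def grng_Tight)
  moreover have "openin (Gtop m) U" if "U \<in> range (\<lambda>g. slice g (Tight m))" for U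
    using that openin_slice[OF openin_topspace[of "Ttop m"]] by auto
  ultimately obtain \<F> where \<F>: "finite \<F>" "\<F> \<subseteq> range (\<lambda>g. slice g (Tight m))" "B \<subseteq> \<Union>\<F>"
    using compactinD[OF B, of "range (\<lambda>g. slice g (Tight m))"] by blast
  then obtain K where K: "finite K" "\<F> = (\<lambda>g. slice g (Tight m)) ` K"
    using finite_subset_image[OF \<F>(1,2)] by blast
  have "grade ` B \<subseteq> K"
    using \<F>(3) K(2) by (auto simp: slice_def)
  then show ?thesis
    using K(1) finite_subset by blast
qed

section \<open>Locally constant functions\<close>

text \<open>Local constancy together with compact support in \<open>Dg\<close>. In this form closure
  under the algebra operations needs only openness of level sets; finiteness of the range is
  recovered from compactness.\<close>

lemma Lcg_iff:
  fixes f :: "'a set \<Rightarrow> 'r::comm_ring_1"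
  shows "f \<in> Lcg m z \<phi> g \<longleftrightarrow>
    (\<exists>K. compactin (Ttop m) K \<and> K \<subseteq> Dg m z \<phi> g \<and> (\<forall>F. F \<notin> K \<longrightarrow> f F = 0)) \<and>
    (\<forall>r. openin (Ttop m) {F \<in> Tight m. f F = r})" (is "?L \<longleftrightarrow> ?R")
proof
  assume L: ?L
  then have off: "\<And>F. F \<notin> Tight m \<Longrightarrow> f F = 0" and fin: "finite (range f)"
    and lev: "\<And>r. r \<noteq> 0 \<Longrightarrow> {F. f F = r} \<in> Tcg m z \<phi> g"
    by (auto simp: Lcg_def)
  define K where "K = (\<Union>r \<in> range f - {0}. {F. f F = r})"
  have K: "compactin (Ttop m) K"
    unfolding K_def using fin lev by (intro compactin_Union) (auto simp: Tcg_def)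
  have KD: "K \<subseteq> Dg m z \<phi> g"
    unfolding K_def using lev by (fastforce simp: Tcg_def)
  have K0: "F \<notin> K \<longleftrightarrow> f F = 0" for F
    by (auto simp: K_def)
  have "openin (Ttop m) {F \<in> Tight m. f F = r}" for r
  proof (cases "r = 0")
    case True
    \<comment> \<open>The zero level set is the complement of the support, which is compact and
      therefore closed in a Hausdorff space.\<close>
    have "{F \<in> Tight m. f F = r} = topspace (Ttop m) - K"
      using K0 True by auto
    then show ?thesis
      using compactin_imp_closedin[OF Hausdorff_Ttop K] by (simp add: closedin_def)
  next
    case False
    have "{F \<in> Tight m. f F = r} = {F. f F = r}"
      using off False by auto
    then show ?thesis
      using lev[OF False] by (simp add: Tcg_def)
  qed
  then show ?R
    using K KD K0 by blast
next
  assume R: ?R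
  then obtain K where K: "compactin (Ttop m) K" "K \<subseteq> Dg m z \<phi> g" and K0: "\<And>F. F \<notin> K \<Longrightarrow> f F = 0"
    by blast
  have op: "openin (Ttop m) {F \<in> Tight m. f F = r}" for r
    using R by blast
  have KT: "K \<subseteq> Tight m"
    using K(2) Dg_Tight by blast
  let ?\<U> = "range (\<lambda>r. {F \<in> Tight m. f F = r})"
  have "K \<subseteq> \<Union>?\<U>"
    using KT by auto
  then obtain \<F> where \<F>: "finite \<F>" "\<F> \<subseteq> ?\<U>" "K \<subseteq> \<Union>\<F>"
    using compactinD[OF K(1), of ?\<U>] op by blast
  then obtain Q where Q: "finite Q" "\<F> = (\<lambda>r. {F \<in> Tight m. f F = r}) ` Q"
    using finite_subset_image[OF \<F>(1,2)] by blast
  have "range f \<subseteq> insert 0 Q"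
  proof
    fix r assume "r \<in> range f"
    then obtain F where F: "r = f F" by blast
    show "r \<in> insert 0 Q"
      using K0[of F] \<F>(3) unfolding Q(2) F by (cases "F \<in> K") auto
  qed
  then have fin: "finite (range f)"
    using Q(1) finite_subset by blast
  have lev: "{F. f F = r} \<in> Tcg m z \<phi> g" if "r \<noteq> 0" for r
  proof -
    have eq: "{F. f F = r} = {F \<in> Tight m. f F = r}"
      using K0 KT that by blast
    \<comment> \<open>The other level sets are open and cover the complement, so this one is closed;
      for nonzero \<open>r\<close> it lies in \<open>K\<close> and is therefore compact.\<close>
    have "topspace (Ttop m) - {F \<in> Tight m. f F = r} = (\<Union>q\<in>-{r}. {F \<in> Tight m. f F = q})"
      by auto
    moreover have "openin (Ttop m) (\<Union>q\<in>-{r}. {F \<in> Tight m. f F = q})"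
      using op by (intro openin_Union) auto
    ultimately have "closedin (Ttop m) {F \<in> Tight m. f F = r}"
      by (simp add: closedin_def)
    moreover have sub: "{F \<in> Tight m. f F = r} \<subseteq> K"
      using K0 that by blast
    ultimately have "compactin (Ttop m) {F \<in> Tight m. f F = r}"
      using closed_compactin[OF K(1)] by blast
    then show ?thesis
      using eq op[of r] sub K(2) unfolding Tcg_def by auto
  qed
  show ?L
    using K0 KT fin lev unfolding Lcg_def by blast
qed

lemma Lcg_eq_zero: "f \<in> Lcg m z \<phi> g \<Longrightarrow> F \<notin> Dg m z \<phi> g \<Longrightarrow> f F = 0"
  by (auto simp: Lcg_iff)

lemma Lcg_level: "f \<in> Lcg m z \<phi> g \<Longrightarrow> r \<noteq> 0 \<Longrightarrow> {F. f F = r} \<in> Tcg m z \<phi> g"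
  by (simp add: Lcg_def)

lemma Lcg_zero: "(\<lambda>_. 0 :: 'r::comm_ring_1) \<in> Lcg m z \<phi> g"
proof -
  have "openin (Ttop m) {F \<in> Tight m. 0 = r}" for r :: 'r
    using openin_topspace[of "Ttop m"] by (cases "0 = r") auto
  then show ?thesis
    unfolding Lcg_iff by (intro conjI exI[of _ "{}"]) auto
qed

lemma Lcg_add:
  assumes f: "f \<in> Lcg m z \<phi> g" and f': "f' \<in> Lcg m z \<phi> g"
  shows "(\<lambda>F. f F + f' F) \<in> Lcg m z \<phi> g"
proof -
  obtain K K' where K: "compactin (Ttop m) K" "K \<subseteq> Dg m z \<phi> g" "\<And>F. F \<notin> K \<Longrightarrow> f F = 0"
    and K': "compactin (Ttop m) K'" "K' \<subseteq> Dg m z \<phi> g" "\<And>F. F \<notin> K' \<Longrightarrow> f' F = 0"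
    using f f' unfolding Lcg_iff by blast
  have op: "openin (Ttop m) {F \<in> Tight m. f F = r}" "openin (Ttop m) {F \<in> Tight m. f' F = r}" for r
    using f f' unfolding Lcg_iff by blast+
  have "openin (Ttop m) {F \<in> Tight m. f F + f' F = r}" for r
  proof -
    have "{F \<in> Tight m. f F + f' F = r} =
        (\<Union>a. {F \<in> Tight m. f F = a} \<inter> {F \<in> Tight m. f' F = r - a})"
      by (auto simp: algebra_simps)
    then show ?thesis
      using openin_Int[OF op] by auto
  qed
  then show ?thesis
    unfolding Lcg_iff using K K' compactin_Un[OF K(1) K'(1)]
    by (intro conjI exI[of _ "K \<union> K'"]) auto
qed

lemma Lcg_scale:
  assumes f: "f \<in> Lcg m z \<phi> g"
  shows "(\<lambda>F. c * f F) \<in> Lcg m z \<phi> g"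
proof -
  obtain K where K: "compactin (Ttop m) K" "K \<subseteq> Dg m z \<phi> g" "\<And>F. F \<notin> K \<Longrightarrow> f F = 0"
    using f unfolding Lcg_iff by blast
  have op: "openin (Ttop m) {F \<in> Tight m. f F = r}" for r
    using f unfolding Lcg_iff by blast
  have "openin (Ttop m) {F \<in> Tight m. c * f F = r}" for r
  proof -
    \<comment> \<open>Several levels of \<open>f\<close> may merge, since \<open>c\<close> can be
      zero or a zero divisor.\<close>
    have "{F \<in> Tight m. c * f F = r} = (\<Union>a\<in>{a. c * a = r}. {F \<in> Tight m. f F = a})"
      by auto
    then show ?thesis
      using op by auto
  qed
  then show ?thesis
    unfolding Lcg_iff using K by (intro conjI exI[of _ K]) auto
qed

lemma Lcg_indicator:
  assumes A: "A \<in> Tcg m z \<phi> g"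
  shows "(\<lambda>F. if F \<in> A then 1 else 0 :: 'r::comm_ring_1) \<in> Lcg m z \<phi> g"
proof -
  have A: "compactin (Ttop m) A" "openin (Ttop m) A" "A \<subseteq> Dg m z \<phi> g"
    using A by (auto simp: Tcg_def)
  have AT: "A \<subseteq> Tight m"
    using A(3) Dg_Tight by blast
  have cl: "openin (Ttop m) (Tight m - A)"
    using compactin_imp_closedin[OF Hausdorff_Ttop A(1)] by (simp add: closedin_def)
  have "openin (Ttop m) {F \<in> Tight m. (if F \<in> A then 1 else 0) = r}" for r :: 'r
  proof -
    have "{F \<in> Tight m. (if F \<in> A then 1 else 0) = r} =
        (if 1 = r then A else {}) \<union> (if 0 = r then Tight m - A else {})"
      using AT by auto
    then show ?thesis
      using A(2) cl by (auto intro: openin_Un)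
  qed
  then show ?thesis
    unfolding Lcg_iff using A by (intro conjI exI[of _ A]) auto
qed

section \<open>The isomorphism\<close>

definition Psi :: "('g \<Rightarrow> 'a set \<Rightarrow> 'r::comm_ring_1) \<Rightarrow> ('a \<times> 'a set) set \<Rightarrow> 'r" where
  "Psi x \<gamma> = (if \<gamma> \<in> Gtight m then x (grade \<gamma>) (grng m \<gamma>) else 0)"

lemma carr_LR_iff:
  "x \<in> carr (LR m z G \<phi>) \<longleftrightarrow> (\<forall>g. g \<notin> carrier G \<longrightarrow> x g = (\<lambda>_. 0)) \<and>
     finite {g \<in> carrier G. x g \<noteq> (\<lambda>_. 0)} \<and> (\<forall>g\<in>carrier G. x g \<in> Lcg m z \<phi> g)"
  by (simp add: LR_def)

lemma inj_on_Psi: "inj_on Psi (carr (LR m z G \<phi> :: ('g \<Rightarrow> 'a set \<Rightarrow> 'r::comm_ring_1, 'r) ralg))"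
proof (rule inj_onI)
  fix x y :: "'g \<Rightarrow> 'a set \<Rightarrow> 'r"
  assume x: "x \<in> carr (LR m z G \<phi>)" and y: "y \<in> carr (LR m z G \<phi>)" and eq: "Psi x = Psi y"
  have "x g F = y g F" for g F
  proof (cases "g \<in> carrier G \<and> F \<in> Dg m z \<phi> g")
    case True
    then show ?thesis
      using fun_cong[OF eq, of "tau g F"] tau[of F g] by (simp add: Psi_def)
  next
    case False
    then show ?thesis
      using x y Lcg_eq_zero[of "x g" g F] Lcg_eq_zero[of "y g" g F]
      by (cases "g \<in> carrier G") (simp_all add: carr_LR_iff)
  qed
  then show "x = y"
    by blast
qed

text \<open>Allows arbitrary finite index sets, since the sum for \<open>Psi x\<close> runs
  naturally over pairs of a degree and a value.\<close>

lemma carr_steinbergI: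
  fixes c :: "'i \<Rightarrow> 'r::comm_ring_1"
  assumes I: "finite I" and U: "\<And>i. i \<in> I \<Longrightarrow> compact_open_bisection m (U i)"
  shows "(\<lambda>\<gamma>. \<Sum>i\<in>I. c i * (if \<gamma> \<in> U i then 1 else 0)) \<in> carr (steinberg_tight m)"
proof -
  obtain h where h: "bij_betw h {0..<card I} I"
    using ex_bij_betw_nat_finite[OF I] by blast
  then have "compact_open_bisection m (U (h i))" if "i < card I" for i
    using U that bij_betwE by fastforce
  moreover have "(\<lambda>\<gamma>. \<Sum>i\<in>I. c i * (if \<gamma> \<in> U i then 1 else 0)) =
      (\<lambda>\<gamma>. \<Sum>i<card I. c (h i) * (if \<gamma> \<in> U (h i) then 1 else 0))"
    unfolding lessThan_atLeast0 by (intro ext) (rule sum.reindex_bij_betw[OF h, symmetric])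
  ultimately show ?thesis
    unfolding steinberg_tight_def
    by (simp, intro exI[of _ "card I"] exI[of _ "c \<circ> h"] exI[of _ "U \<circ> h"]) simp
qed

lemma Psi_in_steinberg:
  fixes x :: "'g \<Rightarrow> 'a set \<Rightarrow> 'r::comm_ring_1"
  assumes x: "x \<in> carr (LR m z G \<phi>)"
  shows "Psi x \<in> carr (steinberg_tight m)"
proof -
  define I where "I = (SIGMA g : {g \<in> carrier G. x g \<noteq> (\<lambda>_. 0)}. range (x g) - {0})"
  define U where "U = (\<lambda>(g, r). slice g {F. x g F = r})"
  have "finite I"
    unfolding I_def using x by (intro finite_SigmaI) (auto simp: carr_LR_iff Lcg_def)
  moreover have "compact_open_bisection m (U p)" if "p \<in> I" for p
    using that x Lcg_level[of "x (fst p)" "fst p" "snd p"]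
    by (auto simp: I_def U_def carr_LR_iff intro!: slice_compact_open_bisection)
  ultimately have "(\<lambda>\<gamma>. \<Sum>p\<in>I. snd p * (if \<gamma> \<in> U p then 1 else 0)) \<in> carr (steinberg_tight m)"
    by (rule carr_steinbergI)
  moreover have "Psi x \<gamma> = (\<Sum>p\<in>I. snd p * (if \<gamma> \<in> U p then 1 else 0))" for \<gamma>
  proof (cases "\<gamma> \<in> Gtight m")
    case True
    define q where "q = (grade \<gamma>, x (grade \<gamma>) (grng m \<gamma>))"
    \<comment> \<open>The slices over the level sets are pairwise disjoint, so at most one term of
      the sum survives.\<close>
    have "\<gamma> \<in> U p \<longleftrightarrow> p = q" for p
      using True by (cases p) (auto simp: U_def q_def slice_def)
    then have "(\<Sum>p\<in>I. snd p * (if \<gamma> \<in> U p then 1 else 0)) = (\<Sum>p\<in>I. if p = q then snd q else 0)"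
      by (intro sum.cong) auto
    also have "\<dots> = (if q \<in> I then snd q else 0)"
      using \<open>finite I\<close> by simp
    \<comment> \<open>If \<open>q\<close> is not in \<open>I\<close>, the value of \<open>x\<close>
      at this germ is zero and both sides vanish.\<close>
    also have "\<dots> = snd q"
      using grade_closed[OF True] by (auto simp: I_def q_def)
    finally show ?thesis
      using True by (simp add: Psi_def q_def)
  next
    case False
    then have "\<gamma> \<notin> U p" for p
      by (cases p) (auto simp: U_def slice_def)
    then show ?thesis
      using False by (simp add: Psi_def)
  qed
  ultimately show ?thesis
    by presburger
qed

lemma Dg_empty: "g \<notin> carrier G \<Longrightarrow> Dg m z \<phi> g = {}"
  using phi_closed by (auto simp: mem_Dg_iff)

text \<open>The induction step for surjectivity. The indicator of \<open>U\<close> comes from the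
  family of indicators of its degree parts, each transported to the tight spectrum by
  \<open>tau\<close>; compactness of \<open>U\<close> leaves finitely many nonzero members.\<close>

lemma add_indicator_in_carr_LR:
  fixes x :: "'g \<Rightarrow> 'a set \<Rightarrow> 'r::comm_ring_1" and c :: 'r
  assumes x: "x \<in> carr (LR m z G \<phi>)" and U: "compact_open_bisection m U"
  defines "y \<equiv> \<lambda>g F. x g F + c * (if F \<in> {F \<in> Dg m z \<phi> g. tau g F \<in> U} then 1 else 0)"
  shows "y \<in> carr (LR m z G \<phi>)" "Psi y = (\<lambda>\<gamma>. Psi x \<gamma> + c * (if \<gamma> \<in> U then 1 else 0))"
proof -
  have U': "compactin (Gtop m) U" "openin (Gtop m) U"
    using U by (auto simp: compact_open_bisection_def)
  have UG: "U \<subseteq> Gtight m"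
    using openin_subset[OF U'(2)] by simp
  show "y \<in> carr (LR m z G \<phi>)"
    unfolding carr_LR_iff
  proof (intro conjI allI impI ballI)
    show "y g = (\<lambda>_. 0)" if "g \<notin> carrier G" for g
      using x that Dg_empty[OF that] by (simp add: y_def carr_LR_iff)
    show "y g \<in> Lcg m z \<phi> g" if "g \<in> carrier G" for g
      unfolding y_def
      using x that tau_vimage_Tcg[OF U']
      by (intro Lcg_add Lcg_scale Lcg_indicator) (simp_all add: carr_LR_iff)
    have "g \<in> grade ` U" if xy: "x g = (\<lambda>_. 0)" "y g \<noteq> (\<lambda>_. 0)" for g
    proof -
      obtain F where "y g F \<noteq> 0"
        using xy(2) by blast
      then have "F \<in> Dg m z \<phi> g" "tau g F \<in> U"
        using xy(1) by (auto simp: y_def split: if_splits)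
      then show ?thesis
        using tau(2)[of F g] by (metis imageI)
    qed
    then have "{g \<in> carrier G. y g \<noteq> (\<lambda>_. 0)} \<subseteq> {g \<in> carrier G. x g \<noteq> (\<lambda>_. 0)} \<union> grade ` U"
      by blast
    then show "finite {g \<in> carrier G. y g \<noteq> (\<lambda>_. 0)}"
      using x finite_grade_image[OF U'(1)] by (auto simp: carr_LR_iff intro: finite_subset)
  qed
  show "Psi y = (\<lambda>\<gamma>. Psi x \<gamma> + c * (if \<gamma> \<in> U then 1 else 0))"
    using UG by (intro ext) (auto simp: Psi_def y_def tau_eq grng_Dg)
qed

lemma Psi_surj:
  fixes f :: "('a \<times> 'a set) set \<Rightarrow> 'r::comm_ring_1"
  assumes "f \<in> carr (steinberg_tight m)"
  shows "f \<in> Psi ` carr (LR m z G \<phi>)"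
proof -
  have "(\<lambda>\<gamma>. \<Sum>i<n. r i * (if \<gamma> \<in> U i then 1 else 0)) \<in> Psi ` carr (LR m z G \<phi>)"
    if "\<forall>i<n. compact_open_bisection m (U i)" for n :: nat and r :: "nat \<Rightarrow> 'r" and U
    using that
  proof (induction n)
    case 0
    have "(\<lambda>_ _. 0 :: 'r) \<in> carr (LR m z G \<phi>)"
      by (simp add: carr_LR_iff Lcg_zero)
    moreover have "Psi (\<lambda>_ _. 0 :: 'r) = (\<lambda>_. 0)"
      by (auto simp: Psi_def)
    ultimately show ?case
      by (auto intro: image_eqI[OF sym])
  next
    case (Suc n)
    then obtain x where x: "x \<in> carr (LR m z G \<phi>)"
      and eq: "(\<lambda>\<gamma>. \<Sum>i<n. r i * (if \<gamma> \<in> U i then 1 else 0)) = Psi x"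
      by auto
    have "compact_open_bisection m (U n)"
      using Suc.prems by simp
    note y = add_indicator_in_carr_LR[OF x this, of "r n"]
    have "(\<lambda>\<gamma>. \<Sum>i<Suc n. r i * (if \<gamma> \<in> U i then 1 else 0)) =
        (\<lambda>\<gamma>. Psi x \<gamma> + r n * (if \<gamma> \<in> U n then 1 else 0))"
      by (simp flip: eq)
    then show ?case
      using y by (metis (no_types, lifting) image_eqI)
  qed
  then show ?thesis
    using assms by (auto simp: steinberg_tight_def)
qed

text \<open>The cancellation of the action of \<open>s\<close> against that of its inverse is read
  off the germ \<open>tau s F\<close>: its source is the image of \<open>F\<close> under the inverse
  degree, and its range is \<open>F\<close> again.\<close>

lemma tphi_mult:
  fixes a b :: "'a set \<Rightarrow> 'r::comm_ring_1"
  assumes s: "s \<in> carrier G"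
  shows "tphi m z G \<phi> s (\<lambda>\<xi>. tphi m z G \<phi> (ginv s) a \<xi> * b \<xi>) F =
    (if F \<in> Dg m z \<phi> s then a F * b (hg m z G \<phi> (ginv s) F) else 0)"
proof (cases "F \<in> Dg m z \<phi> s")
  case True
  note t = tau[OF True]
  have "hg m z G \<phi> (ginv s) F = gsrc (tau s F)"
    using gsrc_eq[OF t(1)] t by simp
  then show ?thesis
    using True s gsrc_Dg[OF t(1)] grng_eq[OF t(1)] t by (simp add: tphi_def)
qed (simp add: tphi_def)

text \<open>In a factorisation of \<open>\<gamma>\<close> the left factor has the range of
  \<open>\<gamma>\<close>, so its degree \<open>s\<close> determines it. The right factor is then
  fixed by its degree, \<open>s\<close> inverse times \<open>g\<close>, and by its range, the source
  of the left factor. The convolution thus becomes a sum over \<open>s\<close>.\<close>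

lemma Psi_mult:
  fixes x y :: "'g \<Rightarrow> 'a set \<Rightarrow> 'r::comm_ring_1"
  assumes x: "x \<in> carr (LR m z G \<phi>)" and y: "y \<in> carr (LR m z G \<phi>)"
  shows "Psi (mul (LR m z G \<phi>) x y) = mul (steinberg_tight m) (Psi x) (Psi y)"
proof
  fix \<gamma>
  define P where "P = {(\<alpha>, \<beta>). \<alpha> \<in> Gtight m \<and> \<beta> \<in> Gtight m \<and>
      gsrc \<alpha> = grng m \<beta> \<and> gmul m \<alpha> \<beta> = \<gamma> \<and> Psi x \<alpha> \<noteq> 0 \<and> Psi y \<beta> \<noteq> 0}"
  have R: "mul (steinberg_tight m) (Psi x) (Psi y) \<gamma> = (\<Sum>(\<alpha>, \<beta>)\<in>P. Psi x \<alpha> * Psi y \<beta>)"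
    by (simp add: steinberg_tight_def P_def)
  show "Psi (mul (LR m z G \<phi>) x y) \<gamma> = mul (steinberg_tight m) (Psi x) (Psi y) \<gamma>"
  proof (cases "\<gamma> \<in> Gtight m")
    case False
    then have "P = {}"
      using gmul(1) by (auto simp: P_def)
    then show ?thesis
      unfolding R using False by (simp add: Psi_def)
  next
    case True
    define g F where "g = grade \<gamma>" and "F = grng m \<gamma>"
    have g: "g \<in> carrier G"
      using grade_closed[OF True] by (simp add: g_def)
    let ?h = "\<lambda>s. hg m z G \<phi> (ginv s) F"
    let ?S = "{s \<in> carrier G. x s \<noteq> (\<lambda>_. 0)}"
    \<comment> \<open>Exactly the degrees at which both factors are nonzero, matching the support
      conditions in \<open>P\<close>; the product of the two values may still vanish. As
      \<open>S\<close> is finite, the bijection makes the sum over \<open>P\<close> a genuine finite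
      sum.\<close>
    define S where "S = {s \<in> carrier G. F \<in> Dg m z \<phi> s \<and> x s F \<noteq> 0 \<and> y (ginv s \<otimes>\<^bsub>G\<^esub> g) (?h s) \<noteq> 0}"
    have "Psi (mul (LR m z G \<phi>) x y) \<gamma> =
        (\<Sum>s\<in>?S. if F \<in> Dg m z \<phi> s then x s F * y (ginv s \<otimes>\<^bsub>G\<^esub> g) (?h s) else 0)"
      using True g by (simp add: Psi_def LR_def g_def[symmetric] F_def[symmetric] tphi_mult)
    also have "\<dots> = (\<Sum>s\<in>S. x s F * y (ginv s \<otimes>\<^bsub>G\<^esub> g) (?h s))"
      using x by (intro sum.mono_neutral_cong_right) (auto simp: carr_LR_iff S_def)
    also have "\<dots> = (\<Sum>(\<alpha>, \<beta>)\<in>P. Psi x \<alpha> * Psi y \<beta>)"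
    proof (rule sum.reindex_bij_witness[where i = "\<lambda>(\<alpha>, \<beta>). grade \<alpha>"
          and j = "\<lambda>s. (tau s F, tau (ginv s \<otimes>\<^bsub>G\<^esub> g) (?h s))"])
      fix s assume "s \<in> S"
      then have s: "s \<in> carrier G" "F \<in> Dg m z \<phi> s" "x s F \<noteq> 0" "y (ginv s \<otimes>\<^bsub>G\<^esub> g) (?h s) \<noteq> 0"
        by (auto simp: S_def)
      \<comment> \<open>A nonzero coefficient of \<open>y\<close> forces the filter into the domain
        of the remaining degree, so that \<open>tau\<close> yields an actual germ there.\<close>
      have D: "?h s \<in> Dg m z \<phi> (ginv s \<otimes>\<^bsub>G\<^esub> g)"
        using Lcg_eq_zero[of "y (ginv s \<otimes>\<^bsub>G\<^esub> g)" "ginv s \<otimes>\<^bsub>G\<^esub> g" "?h s"] s y g by (auto simp: carr_LR_iff)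
      note \<alpha> = tau[OF s(2)] and \<beta> = tau[OF D]
      have comp: "gsrc (tau s F) = grng m (tau (ginv s \<otimes>\<^bsub>G\<^esub> g) (?h s))"
        using gsrc_eq[OF \<alpha>(1)] \<alpha> \<beta> by simp
      have "gmul m (tau s F) (tau (ginv s \<otimes>\<^bsub>G\<^esub> g) (?h s)) = \<gamma>"
        using gmul[OF \<alpha>(1) \<beta>(1) comp] \<alpha> \<beta> True s(1) g
        by (intro Gtight_eqI_rng) (simp_all add: g_def F_def grp.inv_solve_left' flip: grp.m_assoc)
      then show "(tau s F, tau (ginv s \<otimes>\<^bsub>G\<^esub> g) (?h s)) \<in> P"
        using \<alpha> \<beta> comp s by (simp add: P_def Psi_def)
      show "(case (tau s F, tau (ginv s \<otimes>\<^bsub>G\<^esub> g) (?h s)) of (\<alpha>, \<beta>) \<Rightarrow> grade \<alpha>) = s"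
        using \<alpha> by simp
      show "(case (tau s F, tau (ginv s \<otimes>\<^bsub>G\<^esub> g) (?h s)) of (\<alpha>, \<beta>) \<Rightarrow> Psi x \<alpha> * Psi y \<beta>) =
          x s F * y (ginv s \<otimes>\<^bsub>G\<^esub> g) (?h s)"
        using \<alpha> \<beta> by (simp add: Psi_def)
    next
      fix p assume "p \<in> P"
      then obtain \<alpha> \<beta> where p: "p = (\<alpha>, \<beta>)" and \<alpha>: "\<alpha> \<in> Gtight m" "Psi x \<alpha> \<noteq> 0"
        and \<beta>: "\<beta> \<in> Gtight m" "Psi y \<beta> \<noteq> 0" and comp: "gsrc \<alpha> = grng m \<beta>" and \<gamma>: "gmul m \<alpha> \<beta> = \<gamma>"
        by (auto simp: P_def)
      have F: "F = grng m \<alpha>" and gg: "g = grade \<alpha> \<otimes>\<^bsub>G\<^esub> grade \<beta>"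
        using gmul[OF \<alpha>(1) \<beta>(1) comp] \<gamma> by (simp_all add: F_def g_def)
      have \<beta>g: "ginv (grade \<alpha>) \<otimes>\<^bsub>G\<^esub> g = grade \<beta>"
        using gg grade_closed[OF \<alpha>(1)] grade_closed[OF \<beta>(1)] by (simp flip: grp.m_assoc)
      have h: "?h (grade \<alpha>) = grng m \<beta>"
        using gsrc_eq[OF \<alpha>(1)] comp F by simp
      show "(case p of (\<alpha>, \<beta>) \<Rightarrow> grade \<alpha>) \<in> S"
        using p \<alpha> \<beta> \<beta>g h F grade_closed[OF \<alpha>(1)] grng_Dg[OF \<alpha>(1)] by (simp add: S_def Psi_def)
      show "(tau (case p of (\<alpha>, \<beta>) \<Rightarrow> grade \<alpha>) F,
          tau (ginv (case p of (\<alpha>, \<beta>) \<Rightarrow> grade \<alpha>) \<otimes>\<^bsub>G\<^esub> g) (?h (case p of (\<alpha>, \<beta>) \<Rightarrow> grade \<alpha>))) = p"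
        using p \<beta>g h F tau_eq[OF \<alpha>(1)] tau_eq[OF \<beta>(1)] by simp
    qed
    finally show ?thesis
      unfolding R .
  qed
qed

lemma ralg_iso_Psi:
  "ralg_iso (LR m z G \<phi> :: ('g \<Rightarrow> 'a set \<Rightarrow> 'r::comm_ring_1, 'r) ralg) (steinberg_tight m) Psi"
proof -
  have "Psi ` carr (LR m z G \<phi>) = carr (steinberg_tight m)"
    using Psi_in_steinberg Psi_surj by blast
  then have "bij_betw Psi (carr (LR m z G \<phi>)) (carr (steinberg_tight m))"
    using inj_on_Psi by (simp add: bij_betw_def)
  moreover have "Psi (add (LR m z G \<phi>) x y) = add (steinberg_tight m) (Psi x) (Psi y)"
    for x y :: "'g \<Rightarrow> 'a set \<Rightarrow> 'r"
    by (auto simp: LR_def steinberg_tight_def Psi_def)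
  moreover have "Psi (smul (LR m z G \<phi>) r x) = smul (steinberg_tight m) r (Psi x)"
    for r and x :: "'g \<Rightarrow> 'a set \<Rightarrow> 'r"
    by (auto simp: LR_def steinberg_tight_def Psi_def)
  ultimately show ?thesis
    unfolding ralg_iso_def using Psi_mult by blast
qed

end

theorem mainTheorem15:
  fixes m :: "'a \<Rightarrow> 'a \<Rightarrow> 'a" and z :: 'a
    and G :: "('g, 'b) monoid_scheme" and \<phi> :: "'a \<Rightarrow> 'g"
  assumes "inverse_semigroup_zero m z"
    and "group G"
    and "pure_grading m z G \<phi>"
  shows "ralg_isomorphic (LR m z G \<phi> :: ('g \<Rightarrow> 'a set \<Rightarrow> 'r::comm_ring_1, 'r) ralg)
                         (steinberg_tight m)"
proof -
  interpret purely_graded m z G \<phi>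
    using assms by (intro purely_graded.intro inverse_semigroup.intro purely_graded_axioms.intro)
  show ?thesis
    unfolding ralg_isomorphic_def using ralg_iso_Psi by blast
qed

end
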